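(* Let $r_{\mathrm{e}},a,S>0$ and let the satellite positions form a homogeneous Poisson point process on the sphere of radius $r_{\mathrm{e}}+a$ centered at $O$ with intensity $S/(4\pi(r_{\mathrm{e}}+a)^2)$; a terminal sits at a fixed point $u$ with $|u|=r_{\mathrm{e}}$, and a satellite at angle $\psi$ from $u$ has distance $\sqrt{r_{\mathrm{e}}^2+(r_{\mathrm{e}}+a)^2-2r_{\mathrm{e}}(r_{\mathrm{e}}+a)\cos\psi}$ to the terminal. With $\theta_{\mathrm{min}}$, $\omega_{\mathrm{th}}>0$ define $d_{\mathrm{max}}=\sqrt{r_{\mathrm{e}}^2\sin^2\theta_{\mathrm{min}}+a^2+2r_{\mathrm{e}}a}-r_{\mathrm{e}}\sin\theta_{\mathrm{min}}$, $\psi_{\mathrm{th}}=\sin^{-1}\!\left(\frac{r_{\mathrm{e}}+a}{r_{\mathrm{e}}}\sin\omega_{\mathrm{th}}\right)-\omega_{\mathrm{th}}$, $d_{\mathrm{th}}=\sqrt{r_{\mathrm{e}}^2+(r_{\mathrm{e}}+a)^2-2r_{\mathrm{e}}(r_{\mathrm{e}}+a)\cos\psi_{\mathrm{th}}}$, assume $a<d_{\mathrm{th}}\le d_{\mathrm{max}}$, and let $\bar P_{\mathrm{ser}}^{\mathrm{ml}},\bar P_{\mathrm{ser}}^{\mathrm{sl}},\bar P_{\mathrm{inv}}$ be the probabilities that (respectively) some satellite is at distance $\le d_{\mathrm{th}}$; none is at distance $\le d_{\mathrm{th}}$ but some is at distance in $(d_{\mathrm{th}},d_{\mathrm{max}}]$;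 none is at distance $\le d_{\mathrm{max}}$. Let $s_0$ be the nearest satellite, at distance $d_{s_0}$. Let $h$ be independent of the satellite positions with CDF $F_h(x)=K\sum_{n\ge0}c_n\gamma(1+n,\frac{x}{2b})$, $c_n=\frac{(m)_n\delta^n(2b)^{1+n}}{(n!)^2}$, $K=\left(\frac{2bm}{2bm+\Omega}\right)^m/(2b)$, $\delta=\frac{\Omega/(2bm+\Omega)}{2b}$, $b,m,\Omega>0$. For positive constants $P,g,G_{\mathrm{t}}^{\mathrm{ml}},G_{\mathrm{t}}^{\mathrm{sl}},G_{\mathrm{r}},N_0,W,f_{\mathrm{c}},c,\alpha$ and $R\ge0$, let $\gamma_{s_0}=\frac{PgG_{\mathrm{t}}G_{\mathrm{r}}h(c/(4\pi f_{\mathrm{c}}))^2d_{s_0}^{-\alpha}}{N_0W}$ with $G_{\mathrm{t}}=G_{\mathrm{t}}^{\mathrm{ml}}$ if $d_{s_0}\le d_{\mathrm{th}}$ and $G_{\mathrm{t}}^{\mathrm{sl}}$ otherwise, and let $\bar P_{\mathrm{out}}=\mathbb{P}[\log_2(1+\gamma_{s_0})<R\mid d_{s_0}\le d_{\mathrm{max}}]$, $\bar P_{\mathrm{out}}^{\mathrm{ml}}=\mathbb{P}[\log_2(1+\gamma_{s_0})<R\mid d_{s_0}\le d_{\mathrm{th}}]$, $\bar P_{\mathrm{out}}^{\mathrm{sl}}=\mathbb{P}[\log_2(1+\gamma_{s_0})<R\mid d_{\mathrm{th}}<d_{s_0}\le d_{\mathrm{max}}]$. Let $\beta_S=\frac{S}{4r_{\mathrm{e}}(r_{\mathrm{e}}+a)}$,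 $\bar F_D(x)=1-e^{-\beta_S(x^2-a^2)}$, $w_1=\frac{16\pi^2f_{\mathrm{c}}^2N_0W(2^R-1)}{Pgc^2G_{\mathrm{t}}^{\mathrm{ml}}G_{\mathrm{r}}}$, $w_2=\frac{16\pi^2f_{\mathrm{c}}^2N_0W(2^R-1)}{Pgc^2G_{\mathrm{t}}^{\mathrm{sl}}G_{\mathrm{r}}}$, $$\mathcal{C}_{\mathrm{ml}}[n]=\int_{\frac{w_1a^\alpha}{2b}}^{\frac{w_1d_{\mathrm{th}}^\alpha}{2b}}t^ne^{-t-\beta_S(2bt/w_1)^{2/\alpha}}dt,\qquad \mathcal{C}_{\mathrm{sl}}[n]=\int_{\frac{w_2d_{\mathrm{th}}^\alpha}{2b}}^{\frac{w_2d_{\mathrm{max}}^\alpha}{2b}}t^ne^{-t-\beta_S(2bt/w_2)^{2/\alpha}}dt.$$ Then $\bar P_{\mathrm{out}}=\frac{\bar P_{\mathrm{ser}}^{\mathrm{ml}}}{1-\bar P_{\mathrm{inv}}}\bar P_{\mathrm{out}}^{\mathrm{ml}}+\frac{\bar P_{\mathrm{ser}}^{\mathrm{sl}}}{1-\bar P_{\mathrm{inv}}}\bar P_{\mathrm{out}}^{\mathrm{sl}}$, where $$\bar P_{\mathrm{out}}^{\mathrm{ml}}=\frac{K}{\bar F_D(d_{\mathrm{th}})}\sum_{n=0}^\infty c_n\Big(e^{\beta_Sa^2}\mathcal{C}_{\mathrm{ml}}[n]+\gamma\big(1+n,\tfrac{w_1a^\alpha}{2b}\big)-e^{-\beta_S(d_{\mathrm{th}}^2-a^2)}\gamma\big(1+n,\tfrac{w_1d_{\mathrm{th}}^\alpha}{2b}\big)\Big),$$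 $$\bar P_{\mathrm{out}}^{\mathrm{sl}}=\frac{K}{\bar F_D(d_{\mathrm{max}})-\bar F_D(d_{\mathrm{th}})}\sum_{n=0}^\infty c_n\Big(e^{\beta_Sa^2}\mathcal{C}_{\mathrm{sl}}[n]+e^{-\beta_S(d_{\mathrm{th}}^2-a^2)}\gamma\big(1+n,\tfrac{w_2d_{\mathrm{th}}^\alpha}{2b}\big)-e^{-\beta_S(d_{\mathrm{max}}^2-a^2)}\gamma\big(1+n,\tfrac{w_2d_{\mathrm{max}}^\alpha}{2b}\big)\Big).$$
   Context: $\gamma(s,x)=\int_0^xt^{s-1}e^{-t}dt$ (lower incomplete Gamma function), $(x)_n=\Gamma(x+n)/\Gamma(x)$. $F_h$ is the shadowed-Rician fading CDF. In the paper the barred quantities are the Poisson-limit "approximations" of the outage probabilities of a system of $S$ satellites placed i.i.d. uniformly on the sphere: they are defined as the corresponding quantities when the satellite positions are replaced by a homogeneous Poisson point process with mean number $S$ of points, which is the model stated here. The terminal is served by the nearest satellite if visible (distance $\le d_{\mathrm{max}}$). *)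

theory Defs
  imports "HOL-Probability.Probability"
begin

definition lower_inc_gamma :: "real \<Rightarrow> real \<Rightarrow> real" where
  "lower_inc_gamma s x = (LBINT t=0..x. t powr (s - 1) * exp (- t))"

text \<open>Surface (area) measure of a Borel subset A of the sphere of radius rho centred at 0
  in R^3, defined through the cone over A: vol(cone) = rho/3 * area(A).\<close>
definition sphere_area :: "real \<Rightarrow> (real^3) set \<Rightarrow> real" where
  "sphere_area rho A = 3 / rho * measure lebesgue {t *\<^sub>R x | t x. 0 < t \<and> t \<le> 1 \<and> x \<in> A}"

definition sphere_ppp ::
  "'w measure \<Rightarrow> ('w \<Rightarrow> (real^3) set) \<Rightarrow> real \<Rightarrow> real \<Rightarrow> bool" where
  "sphere_ppp M N rho lam \<longleftrightarrow>
     prob_space M \<and>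
     (\<forall>\<omega>\<in>space M. finite (N \<omega>) \<and> N \<omega> \<subseteq> sphere 0 rho) \<and>
     (\<forall>A \<in> sets borel. A \<subseteq> sphere 0 rho \<longrightarrow>
        (\<lambda>\<omega>. card (N \<omega> \<inter> A)) \<in> measurable M (count_space UNIV) \<and>
        (\<forall>k::nat. measure M {\<omega> \<in> space M. card (N \<omega> \<inter> A) = k}
            = (lam * sphere_area rho A) ^ k / fact k * exp (- (lam * sphere_area rho A)))) \<and>
     (\<forall>(I::nat set) A. finite I \<longrightarrow> (\<forall>i\<in>I. A i \<in> sets borel \<and> A i \<subseteq> sphere 0 rho) \<longrightarrow>
        disjoint_family_on A I \<longrightarrow>
        prob_space.indep_vars M (\<lambda>_. count_space UNIV) (\<lambda>i \<omega>. card (N \<omega> \<inter> A i)) I)"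

definition indep_of_ppp ::
  "'w measure \<Rightarrow> ('w \<Rightarrow> real) \<Rightarrow> ('w \<Rightarrow> (real^3) set) \<Rightarrow> real \<Rightarrow> bool" where
  "indep_of_ppp M h N rho \<longleftrightarrow>
     (\<forall>(I::nat set) A. finite I \<longrightarrow> (\<forall>i\<in>I. A i \<in> sets borel \<and> A i \<subseteq> sphere 0 rho) \<longrightarrow>
        (\<forall>B\<in>sets borel. \<forall>k::nat\<Rightarrow>nat.
           measure M {\<omega>\<in>space M. h \<omega> \<in> B \<and> (\<forall>i\<in>I. card (N \<omega> \<inter> A i) = k i)}
         = measure M {\<omega>\<in>space M. h \<omega> \<in> B}
           * measure M {\<omega>\<in>space M. \<forall>i\<in>I. card (N \<omega> \<inter> A i) = k i}))"

definition SR_K :: "real \<Rightarrow> real \<Rightarrow> real \<Rightarrow> real" where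
  "SR_K b m \<Omega> = (2*b*m / (2*b*m + \<Omega>)) powr m / (2*b)"
definition SR_delta :: "real \<Rightarrow> real \<Rightarrow> real \<Rightarrow> real" where
  "SR_delta b m \<Omega> = (\<Omega> / (2*b*m + \<Omega>)) / (2*b)"
definition SR_c :: "real \<Rightarrow> real \<Rightarrow> real \<Rightarrow> nat \<Rightarrow> real" where
  "SR_c b m \<Omega> n = pochhammer m n * SR_delta b m \<Omega> ^ n * (2*b) ^ (1+n) / (fact n)^2"
definition SR_cdf :: "real \<Rightarrow> real \<Rightarrow> real \<Rightarrow> real \<Rightarrow> real" where
  "SR_cdf b m \<Omega> x = SR_K b m \<Omega> * (\<Sum>n. SR_c b m \<Omega> n * lower_inc_gamma (1 + real n) (x / (2*b)))"

end

theory Submission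
  imports Defs
begin

text \<open>
  The void probabilities of the point process give the law of the nearest distance \<open>Y\<close>: the cap of
  points at distance at most \<open>x\<close> from \<open>u\<close> has area \<open>\<pi> \<rho> (x\<^sup>2 - a\<^sup>2) / |u|\<close>, so
  \<open>P(Y > x) = exp (- \<beta> (x\<^sup>2 - a\<^sup>2))\<close>. Almost surely an outage means \<open>h < w Y\<^sup>\<alpha>\<close>. In the joint law of
  the independent pair \<open>(h, Y)\<close> we integrate over \<open>Y\<close> first: for a fixed value \<open>2bt\<close> of \<open>h\<close> the event
  \<open>h < w Y\<^sup>\<alpha>, A < Y \<le> B\<close> is the interval \<open>max A ((2bt/w)\<^bsup>1/\<alpha>\<^esup>) < Y \<le> B\<close>, whose probability is a
  difference of two tails. Since \<open>h / (2b)\<close> has density \<open>\<Sum>n. K c\<^sub>n t\<^sup>n e\<^sup>-\<^sup>t\<close>, integrating termwise gives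
  the stated series directly, without an integration by parts.
\<close>

subsection \<open>The area of a spherical cap\<close>

text \<open>The third coordinate is the outer component of the pair, so that Fubini slices along the
  third axis and each slice lies in a plane.\<close>

definition vec3_of :: "real \<times> real \<times> real \<Rightarrow> real^3" where
  "vec3_of p = vector [fst (snd p), snd (snd p), fst p]"

lemma vec3_of_nth [simp]:
  "vec3_of p $ 1 = fst (snd p)" "vec3_of p $ 2 = snd (snd p)" "vec3_of p $ 3 = fst p"
  by (simp_all add: vec3_of_def)

lemma Basis_vec3: "(Basis :: (real^3) set) = {axis 1 1, axis 2 1, axis 3 1}"
  by (auto simp: Basis_vec_def UNIV_3)

lemma vec3_of_borel [measurable]: "vec3_of \<in> borel_measurable borel"
proof (rule borel_measurable_euclidean_space[THEN iffD2], rule ballI)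
  fix i :: "real^3" assume "i \<in> Basis"
  then consider "i = axis 1 1" | "i = axis 2 1" | "i = axis 3 1"
    by (auto simp: Basis_vec3)
  then show "(\<lambda>x. vec3_of x \<bullet> i) \<in> borel_measurable borel"
    by cases (auto simp: inner_axis borel_prod[symmetric])
qed

text \<open>Preimages of boxes are products of intervals, and values on boxes determine Lebesgue
  measure. Volumes in \<open>real^3\<close> can then be computed by slicing.\<close>

lemma lborel_vec3: "lborel = distr lborel borel vec3_of"
proof (rule lborel_eqI)
  fix l u :: "real^3"
  assume lu: "\<And>b. b \<in> Basis \<Longrightarrow> l \<bullet> b \<le> u \<bullet> b"
  have le: "l $ 1 \<le> u $ 1" "l $ 2 \<le> u $ 2" "l $ 3 \<le> u $ 3"
    using lu[of "axis 1 1"] lu[of "axis 2 1"] lu[of "axis 3 1"]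
    by (auto simp: Basis_vec3 inner_axis)
  have "vec3_of -` box l u = {l$3<..<u$3} \<times> ({l$1<..<u$1} \<times> {l$2<..<u$2})"
    by (auto simp: box_def Basis_vec3 inner_axis)
  then have "emeasure (distr lborel borel vec3_of) (box l u)
      = emeasure (lborel \<Otimes>\<^sub>M (lborel \<Otimes>\<^sub>M lborel)) ({l$3<..<u$3} \<times> ({l$1<..<u$1} \<times> {l$2<..<u$2}))"
    by (simp add: emeasure_distr lborel_prod)
  also have "\<dots> = ennreal (u$3 - l$3) * (ennreal (u$1 - l$1) * ennreal (u$2 - l$2))"
    using le by (subst lborel_prod, subst lborel.emeasure_pair_measure_Times)
       (simp_all add: lborel.emeasure_pair_measure_Times flip: lborel_prod)
  also have "\<dots> = ennreal (\<Prod>b\<in>Basis. (u - l) \<bullet> b)"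
    using le by (simp add: Basis_vec3 inner_axis axis_eq_axis ennreal_mult mult_ac)
  finally show "emeasure (distr lborel borel vec3_of) (box l u) = ennreal (\<Prod>b\<in>Basis. (u - l) \<bullet> b)" .
qed simp

text \<open>Open and closed balls have the same volume, which pins down everything between them.
  Slices therefore need to be known only up to their boundary circles.\<close>

lemma emeasure_between_balls:
  fixes c :: "'a::euclidean_space"
  assumes "ball c r \<subseteq> A" "A \<subseteq> cball c r" "r \<ge> 0" "A \<in> sets borel"
  shows "emeasure lborel A = ennreal (unit_ball_vol (real DIM('a)) * r ^ DIM('a))"
proof (rule antisym)
  show "emeasure lborel A \<le> ennreal (unit_ball_vol (real DIM('a)) * r ^ DIM('a))"
    using emeasure_mono[OF assms(2), of lborel] emeasure_cball[of r c] assms(3) by simp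
  show "ennreal (unit_ball_vol (real DIM('a)) * r ^ DIM('a)) \<le> emeasure lborel A"
    using emeasure_mono[OF assms(1), of lborel] emeasure_ball[of r c] assms(3,4) by simp
qed

lemma norm_vec3_of: "norm (vec3_of p) = sqrt ((fst p)\<^sup>2 + (norm (snd p))\<^sup>2)"
  by (simp add: norm_vec_def L2_set_def sum_3 norm_prod_def)

text \<open>Here \<open>N\<close> is the norm of a point, \<open>z\<close> its height and
  \<open>n\<close> its distance from the axis. Below the rim the cone inequality is the binding one
  and forces the ball inequality; above the rim the roles are exchanged.\<close>

lemma disc_imp_cone:
  fixes k z n N \<rho> :: real
  assumes "N\<^sup>2 = z\<^sup>2 + n\<^sup>2" "0 \<le> N" "0 < z" "0 \<le> k" "0 < \<rho>"
    and n: "n\<^sup>2 < (if z \<le> k * \<rho> then z\<^sup>2 * (1 - k\<^sup>2) / k\<^sup>2 else \<rho>\<^sup>2 - z\<^sup>2)"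
  shows "N \<le> \<rho> \<and> k * N < z"
proof (cases "z \<le> k * \<rho>")
  case True
  then have "k > 0" using assms by (cases "k = 0") auto
  have "(k * N)\<^sup>2 < z\<^sup>2"
    using n True \<open>k > 0\<close> assms(1) by (simp add: field_simps power_mult_distrib)
  then have "k * N < z" using assms(3) power_less_imp_less_base less_imp_le by blast
  then have "k * N < k * \<rho>" using True by simp
  then show ?thesis using \<open>k > 0\<close> \<open>k * N < z\<close> by simp
next
  case False
  then have "N\<^sup>2 < \<rho>\<^sup>2" using n assms(1) by simp
  then have "N < \<rho>" using assms(5) power_less_imp_less_base less_imp_le by blast
  then have "k * N \<le> k * \<rho>" using assms(4) by (intro mult_left_mono) auto
  then show ?thesis using \<open>N < \<rho>\<close> False by simp
qed

lemma cone_imp_disc: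
  fixes k z n N \<rho> :: real
  assumes "N\<^sup>2 = z\<^sup>2 + n\<^sup>2" "0 \<le> N" "0 < z" "0 \<le> k" "0 < \<rho>"
    and "N \<le> \<rho>" "k * N \<le> z"
  shows "n\<^sup>2 \<le> (if z \<le> k * \<rho> then z\<^sup>2 * (1 - k\<^sup>2) / k\<^sup>2 else \<rho>\<^sup>2 - z\<^sup>2)"
proof (cases "z \<le> k * \<rho>")
  case True
  then have "k > 0" using assms by (cases "k = 0") auto
  have "(k * N)\<^sup>2 \<le> z\<^sup>2" using assms by (intro power_mono) auto
  then show ?thesis using True \<open>k > 0\<close> assms(1) by (simp add: field_simps power_mult_distrib)
next
  case False
  have "N\<^sup>2 \<le> \<rho>\<^sup>2" using assms by (intro power_mono) auto
  then show ?thesis using False assms(1) by simp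
qed

text \<open>The slice at height \<open>z\<close> is a disc of squared radius \<open>z\<^sup>2 (1 - k\<^sup>2) / k\<^sup>2\<close> below the rim of
  the cone (\<open>z = k \<rho>\<close>) and of squared radius \<open>\<rho>\<^sup>2 - z\<^sup>2\<close> above it. Both the strict and the non-strict
  cone are covered, since the cone with a negative \<open>k\<close> is the complement of a strict one.\<close>
lemma emeasure_axis_cone:
  fixes C :: "(real^3) set"
  assumes k: "0 \<le> k" "k \<le> 1" and \<rho>: "0 < \<rho>" and C: "C \<in> sets borel"
    and lower: "{y. norm y \<le> \<rho> \<and> k * norm y < y $ 3} \<subseteq> C"
    and upper: "C \<subseteq> {y. norm y \<le> \<rho> \<and> k * norm y \<le> y $ 3}"
  shows "emeasure lborel C = ennreal (2 * pi * \<rho> ^ 3 * (1 - k) / 3)"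
proof -
  define q where "q z = (if z \<le> k * \<rho> then z\<^sup>2 * (1 - k\<^sup>2) / k\<^sup>2 else \<rho>\<^sup>2 - z\<^sup>2)" for z
  have k\<rho>: "0 \<le> k * \<rho>" "k * \<rho> \<le> \<rho>" using k \<rho> by (auto simp: mult_left_le_one_le)
  have k2: "k\<^sup>2 \<le> 1" using k by (simp add: power_le_one)
  define Q where "Q = (1 - k\<^sup>2) / k\<^sup>2"
  have Q: "0 \<le> Q" using k2 by (simp add: Q_def)
  have mC: "vec3_of -` C \<in> sets borel"
    using measurable_sets[OF vec3_of_borel C] by simp
  \<comment> \<open>For \<open>k = 0\<close> the set \<open>C\<close> may contain any part of the
    disc at height 0. A single height is null, so it is left out.\<close>
  have slice: "emeasure lborel (Pair z -` (vec3_of -` C)) = ennreal (pi * q z) * indicator {0<..\<rho>} z"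
    (is "emeasure lborel ?A = _") if "z \<noteq> 0" for z
  proof -
    define N where "N p = norm (vec3_of (z, p))" for p
    have N2: "(N p)\<^sup>2 = z\<^sup>2 + (norm p)\<^sup>2" and Nnn: "0 \<le> N p" for p
      by (auto simp: N_def norm_vec3_of)
    show ?thesis
    proof (cases "0 < z \<and> z \<le> \<rho>")
      case True
      have qnn: "0 \<le> q z"
        using True k2 by (auto simp: q_def power_mono)
      have lo: "ball 0 (sqrt (q z)) \<subseteq> ?A"
      proof
        fix p :: "real \<times> real" assume "p \<in> ball 0 (sqrt (q z))"
        then have "norm p < sqrt (q z)" by simp
        then have "(norm p)\<^sup>2 < (sqrt (q z))\<^sup>2"
          by (intro power_strict_mono) auto
        then have "(norm p)\<^sup>2 < q z" using qnn by simp
        then have "N p \<le> \<rho> \<and> k * N p < z"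
          unfolding q_def by (intro disc_imp_cone[OF N2 Nnn]) (use True k \<rho> in auto)
        then show "p \<in> ?A" using lower by (auto simp: N_def)
      qed
      have up: "?A \<subseteq> cball 0 (sqrt (q z))"
      proof
        fix p assume "p \<in> ?A"
        then have "N p \<le> \<rho>" "k * N p \<le> z" using upper by (auto simp: N_def)
        then have "(norm p)\<^sup>2 \<le> q z"
          unfolding q_def by (intro cone_imp_disc[OF N2 Nnn]) (use True k \<rho> in auto)
        then show "p \<in> cball 0 (sqrt (q z))" by (simp add: real_le_rsqrt)
      qed
      have mA: "?A \<in> sets borel"
        using sets_Pair1[of "vec3_of -` C" "borel :: real measure" "borel :: (real \<times> real) measure" z] mC
        unfolding borel_prod by simp
      have "emeasure lborel ?A = ennreal (unit_ball_vol 2 * sqrt (q z) ^ 2)"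
        using emeasure_between_balls[OF lo up _ mA] qnn by simp
      then show ?thesis using True qnn by (simp add: unit_ball_vol_2)
    next
      case False
      have "p \<notin> ?A" for p
      proof
        assume "p \<in> ?A"
        then have *: "N p \<le> \<rho>" "k * N p \<le> z" using upper by (auto simp: N_def)
        moreover have "\<bar>z\<bar> \<le> N p" unfolding N_def norm_vec3_of by simp
        moreover have "0 \<le> k * N p" using k Nnn by simp
        ultimately show False using False that by linarith
      qed
      then have "?A = {}" by blast
      then show ?thesis using False by auto
    qed
  qed
  have "emeasure lborel C = emeasure (lborel \<Otimes>\<^sub>M lborel) (vec3_of -` C)"
    using C by (subst lborel_vec3) (simp add: emeasure_distr lborel_prod)
  also have "\<dots> = (\<integral>\<^sup>+ z. emeasure lborel (Pair z -` (vec3_of -` C)) \<partial>lborel)"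
    using mC by (intro lborel.emeasure_pair_measure_alt) (simp only: lborel_prod sets_lborel)
  \<comment> \<open>Changing the integrand at the heights 0 and \<open>k * \<rho>\<close> yields
    closed intervals, on each of which the fundamental theorem of calculus applies.\<close>
  also have "\<dots> = (\<integral>\<^sup>+ z. ennreal (pi * (z\<^sup>2 * ((1 - k\<^sup>2) / k\<^sup>2))) * indicator {0..k * \<rho>} z
        + ennreal (pi * (\<rho>\<^sup>2 - z\<^sup>2)) * indicator {k * \<rho>..\<rho>} z \<partial>lborel)"
  proof (rule nn_integral_cong_AE)
    show "AE z in lborel. emeasure lborel (Pair z -` (vec3_of -` C))
        = ennreal (pi * (z\<^sup>2 * ((1 - k\<^sup>2) / k\<^sup>2))) * indicator {0..k * \<rho>} z
          + ennreal (pi * (\<rho>\<^sup>2 - z\<^sup>2)) * indicator {k * \<rho>..\<rho>} z"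
      using AE_lborel_singleton[of 0] AE_lborel_singleton[of "k * \<rho>"]
    proof eventually_elim
      case (elim z)
      then consider "z < 0" | "0 < z" "z < k * \<rho>" | "0 < z" "k * \<rho> < z" "z \<le> \<rho>" | "\<rho> < z"
        by linarith
      then show ?case
        unfolding slice[OF elim(1)] by cases (use k\<rho> in \<open>simp_all add: q_def\<close>)
    qed
  qed
  also have "\<dots> = (\<integral>\<^sup>+ z. ennreal (pi * (z\<^sup>2 * ((1 - k\<^sup>2) / k\<^sup>2))) * indicator {0..k * \<rho>} z \<partial>lborel)
        + (\<integral>\<^sup>+ z. ennreal (pi * (\<rho>\<^sup>2 - z\<^sup>2)) * indicator {k * \<rho>..\<rho>} z \<partial>lborel)"
    by (intro nn_integral_add) simp_all
  also have "(\<integral>\<^sup>+ z. ennreal (pi * (z\<^sup>2 * ((1 - k\<^sup>2) / k\<^sup>2))) * indicator {0..k * \<rho>} z \<partial>lborel)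
      = ennreal (pi * ((k * \<rho>) ^ 3 / 3 * Q) - pi * (0 ^ 3 / 3 * Q))"
    unfolding Q_def[symmetric] using k\<rho> Q
    by (intro nn_integral_FTC_Icc) (auto intro!: derivative_eq_intros)
  also have "pi * ((k * \<rho>) ^ 3 / 3 * Q) - pi * (0 ^ 3 / 3 * Q)
      = pi * (k * \<rho> ^ 3 / 3 * (1 - k\<^sup>2))"
    by (simp add: Q_def power2_eq_square power3_eq_cube)
  also have "(\<integral>\<^sup>+ z. ennreal (pi * (\<rho>\<^sup>2 - z\<^sup>2)) * indicator {k * \<rho>..\<rho>} z \<partial>lborel)
      = ennreal (pi * (\<rho>\<^sup>2 * \<rho> - \<rho> ^ 3 / 3) - pi * (\<rho>\<^sup>2 * (k * \<rho>) - (k * \<rho>) ^ 3 / 3))"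
    using k\<rho>
    by (intro nn_integral_FTC_Icc) (auto intro!: derivative_eq_intros power_mono)
  also have "pi * (\<rho>\<^sup>2 * \<rho> - \<rho> ^ 3 / 3) - pi * (\<rho>\<^sup>2 * (k * \<rho>) - (k * \<rho>) ^ 3 / 3)
      = pi * \<rho> ^ 3 * ((1 - k)\<^sup>2 * (2 + k)) / 3"
    by (simp add: field_simps power2_eq_square power3_eq_cube)
  also have "ennreal (pi * (k * \<rho> ^ 3 / 3 * (1 - k\<^sup>2))) + ennreal (pi * \<rho> ^ 3 * ((1 - k)\<^sup>2 * (2 + k)) / 3)
      = ennreal (pi * (k * \<rho> ^ 3 / 3 * (1 - k\<^sup>2)) + pi * \<rho> ^ 3 * ((1 - k)\<^sup>2 * (2 + k)) / 3)"
    using k k2 \<rho> by (intro ennreal_plus[symmetric] mult_nonneg_nonneg divide_nonneg_pos) simp_all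
  also have "pi * (k * \<rho> ^ 3 / 3 * (1 - k\<^sup>2)) + pi * \<rho> ^ 3 * ((1 - k)\<^sup>2 * (2 + k)) / 3
      = 2 * pi * \<rho> ^ 3 * (1 - k) / 3"
    by (simp add: field_simps power2_eq_square power3_eq_cube)
  finally show ?thesis .
qed

lemma lmeasurable_bounded_borel:
  fixes A :: "'a::euclidean_space set"
  assumes "A \<in> sets borel" "bounded A"
  shows "A \<in> lmeasurable"
  using assms by (intro bounded_set_imp_lmeasurable) auto

lemma measure_axis_cone:
  assumes k: "-1 \<le> k" "k \<le> 1" and \<rho>: "0 < \<rho>"
  shows "measure lebesgue {y::real^3. norm y \<le> \<rho> \<and> k * norm y \<le> y $ 3} = 2 * pi * \<rho> ^ 3 * (1 - k) / 3"
    (is "measure lebesgue ?S = _")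
proof -
  have *: "measure lebesgue C = 2 * pi * \<rho> ^ 3 * (1 - j) / 3"
    if "0 \<le> j" "j \<le> 1" "C \<in> sets borel" "{y. norm y \<le> \<rho> \<and> j * norm y < y $ 3} \<subseteq> C"
      "C \<subseteq> {y. norm y \<le> \<rho> \<and> j * norm y \<le> y $ 3}" for j and C :: "(real^3) set"
    using emeasure_axis_cone[OF that(1,2) \<rho> that(3-5)] that \<rho> by (simp add: measure_def)
  show ?thesis
  proof (cases "0 \<le> k")
    case True
    then show ?thesis using k by (intro *) auto
  next
    \<comment> \<open>The rest of the ball, reflected through the origin, is the strict cone with
      the positive parameter \<open>- k\<close>, whose volume is known.\<close>
    case False
    let ?T = "{y::real^3. norm y \<le> \<rho> \<and> y $ 3 < k * norm y}"
    let ?U = "{y::real^3. norm y \<le> \<rho> \<and> - k * norm y < y $ 3}"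
    have bS: "?S \<in> lmeasurable" and bT: "?T \<in> lmeasurable" and mU: "?U \<in> sets borel"
      by (auto intro!: lmeasurable_bounded_borel boundedI[of _ \<rho>])
    have "4 / 3 * pi * \<rho> ^ 3 = measure lebesgue (cball (0::real^3) \<rho>)"
      using content_cball[of \<rho> "0::real^3"] \<rho> by (simp add: unit_ball_vol_3)
    also have "cball 0 \<rho> = ?S \<union> ?T" by auto
    also have "measure lebesgue (?S \<union> ?T) = measure lebesgue ?S + measure lebesgue (?T - ?S)"
      by (rule measure_Un2[OF bS bT])
    also have "?T - ?S = ?T" by auto
    also have "measure lebesgue ?T = measure lebesgue (uminus ` ?T)"
      using bT by (intro measure_orthogonal_image[symmetric])
        (auto simp: orthogonal_transformation_def linear_iff)
    also have "uminus ` ?T = ?U"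
      by (auto simp: image_iff intro!: exI[of _ "- x" for x])
    also have "measure lebesgue ?U = 2 * pi * \<rho> ^ 3 * (1 - (- k)) / 3"
      using False k mU by (intro *) auto
    finally have "measure lebesgue ?S = 4 / 3 * pi * \<rho> ^ 3 - 2 * pi * \<rho> ^ 3 * (1 - (- k)) / 3"
      by linarith
    then show ?thesis by (simp add: field_simps)
  qed
qed

text \<open>A rotation taking the third axis to \<open>e\<close> preserves norms and Lebesgue
  measure.\<close>

lemma measure_spherical_cone:
  fixes e :: "real^3"
  assumes "-1 \<le> k" "k \<le> 1" "0 < \<rho>" and e: "norm e = 1"
  shows "measure lebesgue {y. norm y \<le> \<rho> \<and> k * norm y \<le> e \<bullet> y} = 2 * pi * \<rho> ^ 3 * (1 - k) / 3"
proof -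
  obtain f :: "real^3 \<Rightarrow> real^3" where f: "orthogonal_transformation f" "f (axis (3::3) 1) = e"
    by (rule orthogonal_transformation_exists_1[of "axis (3::3) 1" e]) (use e in auto)
  let ?S = "{y::real^3. norm y \<le> \<rho> \<and> k * norm y \<le> y $ 3}"
  have f_inner: "e \<bullet> f x = x $ 3" and f_norm: "norm (f x) = norm x" for x
    using f(1) unfolding f(2)[symmetric]
    by (auto simp: orthogonal_transformation_def orthogonal_transformation_norm inner_axis')
  have "f ` ?S = {y. norm y \<le> \<rho> \<and> k * norm y \<le> e \<bullet> y}"
  proof (intro equalityI subsetI)
    fix y assume y: "y \<in> {y. norm y \<le> \<rho> \<and> k * norm y \<le> e \<bullet> y}"
    obtain x where x: "y = f x" using orthogonal_transformation_surj[OF f(1)] by blast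
    show "y \<in> f ` ?S" unfolding x
      by (rule imageI) (use y in \<open>simp add: x f_inner f_norm\<close>)
  qed (auto simp: f_inner f_norm)
  moreover have "?S \<in> lmeasurable"
    by (auto intro!: lmeasurable_bounded_borel boundedI[of _ \<rho>])
  ultimately show ?thesis
    using measure_orthogonal_image[OF f(1), of ?S] measure_axis_cone[OF assms(1-3)] by (simp only:)
qed

text \<open>By the law of cosines, distance at most \<open>d\<close> from \<open>u\<close> means
  that the cosine of the angle to \<open>u\<close> is at least \<open>k\<close>; the bounds on
  \<open>d\<close> place \<open>k\<close> between -1 and 1. The result is Archimedes' formula
  \<open>2 * pi * \<rho>^2 * (1 - k)\<close> written in terms of \<open>d\<close>.\<close>

lemma sphere_area_cap:
  fixes u :: "real^3"
  assumes u: "0 < norm u" and \<rho>: "0 < \<rho>" and d: "\<bar>\<rho> - norm u\<bar> \<le> d" "d \<le> \<rho> + norm u"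
  shows "sphere_area \<rho> {s \<in> sphere 0 \<rho>. dist u s \<le> d} = pi * \<rho> * (d\<^sup>2 - (\<rho> - norm u)\<^sup>2) / norm u"
proof -
  define r where "r = norm u"
  define k where "k = (r\<^sup>2 + \<rho>\<^sup>2 - d\<^sup>2) / (2 * r * \<rho>)"
  define e where "e = u /\<^sub>R r"
  have r: "0 < r" using u by (simp add: r_def)
  have e: "norm e = 1" using r by (simp add: e_def r_def)
  have d2: "(\<rho> - r)\<^sup>2 \<le> d\<^sup>2" "d\<^sup>2 \<le> (\<rho> + r)\<^sup>2"
    using d by (auto simp: r_def abs_le_square_iff[symmetric] intro!: power_mono)
  have k: "-1 \<le> k" "k \<le> 1"
    using d2 r \<rho> by (auto simp: k_def field_simps power2_eq_square)
  have cap: "dist u s \<le> d \<longleftrightarrow> k * \<rho> \<le> e \<bullet> s" if "norm s = \<rho>" for s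
  proof -
    have "dist u s \<le> d \<longleftrightarrow> (dist u s)\<^sup>2 \<le> d\<^sup>2"
      using d abs_le_square_iff[of "dist u s" d] by simp
    also have "(dist u s)\<^sup>2 = r\<^sup>2 + \<rho>\<^sup>2 - 2 * (u \<bullet> s)"
      using that by (simp add: dist_norm power2_norm_eq_inner r_def inner_diff_left inner_diff_right inner_commute
          flip: that)
    also have "u \<bullet> s = r * (e \<bullet> s)" using r by (simp add: e_def)
    finally have "dist u s \<le> d \<longleftrightarrow> (r\<^sup>2 + \<rho>\<^sup>2 - d\<^sup>2) / (2 * r) \<le> e \<bullet> s"
      using r by (simp add: field_simps)
    moreover have "k * \<rho> = (r\<^sup>2 + \<rho>\<^sup>2 - d\<^sup>2) / (2 * r)" using \<rho> by (simp add: k_def)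
    ultimately show ?thesis by simp
  qed
  let ?C = "{t *\<^sub>R x | t x. 0 < t \<and> t \<le> 1 \<and> x \<in> {s \<in> sphere 0 \<rho>. dist u s \<le> d}}"
  let ?S = "{y. norm y \<le> \<rho> \<and> k * norm y \<le> e \<bullet> y}"
  \<comment> \<open>The condition is homogeneous in \<open>y\<close>, so the rays through the cap
    fill the solid cone. Only the apex is missing, because \<open>t > 0\<close>, and it is
    null.\<close>
  have "?C = ?S - {0}"
  proof (intro equalityI subsetI)
    fix y assume "y \<in> ?C"
    then obtain t s where *: "y = t *\<^sub>R s" "0 < t" "t \<le> 1" "norm s = \<rho>" "dist u s \<le> d" by auto
    then have "t * (k * \<rho>) \<le> t * (e \<bullet> s)" using cap by (intro mult_left_mono) auto
    then show "y \<in> ?S - {0}" using * \<rho> by (auto simp: mult_ac mult_left_le_one_le)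
  next
    fix y assume y: "y \<in> ?S - {0}"
    then have n: "0 < norm y" by auto
    define s where "s = (\<rho> / norm y) *\<^sub>R y"
    have ns: "norm s = \<rho>" using n \<rho> by (simp add: s_def)
    have "(\<rho> / norm y) * (k * norm y) \<le> (\<rho> / norm y) * (e \<bullet> y)"
      using y n by (intro mult_left_mono divide_nonneg_pos less_imp_le[OF \<rho>]) auto
    then have "k * \<rho> \<le> e \<bullet> s" using n by (simp add: s_def mult_ac)
    then have "dist u s \<le> d" using cap ns by simp
    moreover have "y = (norm y / \<rho>) *\<^sub>R s" using n \<rho> by (simp add: s_def)
    moreover have "0 < norm y / \<rho>" "norm y / \<rho> \<le> 1" using n \<rho> y by auto
    ultimately show "y \<in> ?C" using ns by (intro CollectI exI[of _ "norm y / \<rho>"] exI[of _ s]) auto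
  qed
  moreover have "measure lebesgue (?S - {0}) = measure lebesgue ?S"
    by (intro measure_Diff_null_set) (auto simp: negligible_iff_null_sets[symmetric])
  ultimately have "sphere_area \<rho> {s \<in> sphere 0 \<rho>. dist u s \<le> d} = 3 / \<rho> * (2 * pi * \<rho> ^ 3 * (1 - k) / 3)"
    unfolding sphere_area_def using measure_spherical_cone[OF k \<rho> e] by (simp only:)
  also have "1 - k = (d\<^sup>2 - (\<rho> - r)\<^sup>2) / (2 * r * \<rho>)"
    using r \<rho> by (simp add: k_def field_simps power2_eq_square)
  also have "3 / \<rho> * (2 * pi * \<rho> ^ 3 * ((d\<^sup>2 - (\<rho> - r)\<^sup>2) / (2 * r * \<rho>)) / 3) = pi * \<rho> * (d\<^sup>2 - (\<rho> - r)\<^sup>2) / r"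
    using r \<rho> by (simp add: power3_eq_cube)
  finally show ?thesis by (simp add: r_def)
qed

subsection \<open>Mixtures of Gamma densities\<close>

text \<open>Fubini and termwise integration are carried out with extended nonnegative integrals, the
  final formulas use interval integrals; continuity on the compact interval links the two.\<close>

lemma nn_integral_Icc_eq_interval_integral:
  fixes f :: "real \<Rightarrow> real"
  assumes "x \<le> y" "continuous_on {x..y} f" "\<And>t. x \<le> t \<Longrightarrow> t \<le> y \<Longrightarrow> 0 \<le> f t"
  shows "(\<integral>\<^sup>+ t. ennreal (f t) * indicator {x..y} t \<partial>lborel) = ennreal (LBINT t=x..y. f t)"
    and "0 \<le> (LBINT t=x..y. f t)"
proof -
  have eq: "(LBINT t=x..y. f t) = (\<integral>t. indicator {x..y} t *\<^sub>R f t \<partial>lborel)"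
    using assms(1) by (simp add: interval_integral_Icc set_lebesgue_integral_def)
  have "integrable lborel (\<lambda>t. indicator {x..y} t *\<^sub>R f t)"
    using borel_integrable_atLeastAtMost'[OF assms(2)] by (simp add: set_integrable_def)
  then have "(\<integral>\<^sup>+ t. ennreal (indicator {x..y} t *\<^sub>R f t) \<partial>lborel) = ennreal (LBINT t=x..y. f t)"
    unfolding eq by (rule nn_integral_eq_integral) (use assms(3) in \<open>auto simp: indicator_def\<close>)
  moreover have "(\<integral>\<^sup>+ t. ennreal (f t) * indicator {x..y} t \<partial>lborel)
      = (\<integral>\<^sup>+ t. ennreal (indicator {x..y} t *\<^sub>R f t) \<partial>lborel)"
    by (intro nn_integral_cong) (auto simp: indicator_def)
  ultimately show "(\<integral>\<^sup>+ t. ennreal (f t) * indicator {x..y} t \<partial>lborel) = ennreal (LBINT t=x..y. f t)"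
    by simp
  show "0 \<le> (LBINT t=x..y. f t)"
    unfolding eq by (rule Bochner_Integration.integral_nonneg) (use assms(3) in \<open>auto simp: indicator_def\<close>)
qed

text \<open>For \<open>t > 0\<close> the two powers agree. The endpoint 0, where
  \<open>0 powr 0\<close> and \<open>0 ^ 0\<close> differ, lies outside the open interval of
  integration.\<close>

lemma lower_inc_gamma_Suc_nat:
  assumes "0 \<le> x"
  shows "lower_inc_gamma (1 + real n) x = (LBINT t=0..x. t ^ n * exp (- t))"
  unfolding lower_inc_gamma_def using assms
  by (intro interval_integral_cong) (auto simp: einterval_iff powr_realpow max_def min_def)

lemma lower_inc_gamma_nonneg: "0 \<le> x \<Longrightarrow> 0 \<le> lower_inc_gamma (1 + real n) x"
  unfolding lower_inc_gamma_Suc_nat zero_ereal_def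
  by (rule nn_integral_Icc_eq_interval_integral(2)) (auto intro!: continuous_intros)

text \<open>The integrand is at most \<open>x ^ n\<close> on \<open>{0..x}\<close>. This crude bound
  reduces convergence of the CDF series to that of a power series.\<close>

lemma lower_inc_gamma_le_power:
  assumes "0 \<le> x"
  shows "lower_inc_gamma (1 + real n) x \<le> x ^ Suc n"
proof -
  have "ennreal (lower_inc_gamma (1 + real n) x)
      = (\<integral>\<^sup>+ t. ennreal (t ^ n * exp (- t)) * indicator {0..x} t \<partial>lborel)"
    unfolding lower_inc_gamma_Suc_nat[OF assms] zero_ereal_def
    by (rule nn_integral_Icc_eq_interval_integral(1)[symmetric])
       (use assms in \<open>auto intro!: continuous_intros\<close>)
  also have "\<dots> \<le> (\<integral>\<^sup>+ t. ennreal (x ^ n) * indicator {0..x} t \<partial>lborel)"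
  proof (rule nn_integral_mono)
    fix t :: real
    have "t ^ n * exp (- t) \<le> x ^ n * 1" if "0 \<le> t" "t \<le> x"
      using that by (intro mult_mono power_mono) auto
    then show "ennreal (t ^ n * exp (- t)) * indicator {0..x} t \<le> ennreal (x ^ n) * indicator {0..x} t"
      by (auto simp: indicator_def intro!: ennreal_leI)
  qed
  also have "\<dots> = ennreal (x ^ Suc n)"
    using assms by (simp add: nn_integral_cmult_indicator ennreal_mult[symmetric] mult.commute)
  finally show ?thesis using assms by (simp add: ennreal_le_iff)
qed

lemma SR_c_nonneg:
  assumes "b > 0" "m > 0" "\<Omega> > 0"
  shows "0 \<le> SR_c b m \<Omega> n"
  using assms by (auto simp: SR_c_def SR_delta_def pochhammer_nonneg intro!: mult_nonneg_nonneg divide_nonneg_pos add_pos_pos)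

text \<open>The squared factorial outgrows the Pochhammer symbol: the quotient of successive terms
  is \<open>(m + n) * q / (n + 1)^2\<close>, which tends to 0.\<close>

lemma SR_c_summable:
  assumes "b > 0" "m > 0" "\<Omega> > 0" "x \<ge> 0"
  shows "summable (\<lambda>n. SR_c b m \<Omega> n * x ^ Suc n)"
proof -
  define q where "q = SR_delta b m \<Omega> * (2 * b) * x"
  have q: "q \<ge> 0" using assms by (auto simp: q_def SR_delta_def intro!: mult_nonneg_nonneg divide_nonneg_pos add_pos_pos)
  \<comment> \<open>With \<open>m + n \<le> (m + 1) * (n + 1)\<close>, this choice bounds the
    quotient by 1/2 for all \<open>n \<ge> k\<close>.\<close>
  obtain k :: nat where k: "2 * (m + 1) * q \<le> real k" using real_arch_simple by blast
  show ?thesis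
  proof (rule summable_ratio_test[where c = "1/2" and N = k])
    fix n assume n: "k \<le> n"
    let ?f = "\<lambda>n. SR_c b m \<Omega> n * x ^ Suc n"
    have f0: "0 \<le> ?f j" for j using assms by (auto intro!: mult_nonneg_nonneg SR_c_nonneg)
    have eq: "?f (Suc n) = (m + real n) * q / (real n + 1)\<^sup>2 * ?f n"
      by (simp add: SR_c_def q_def pochhammer_Suc power2_eq_square field_simps)
    have "(m + real n) * q \<le> ((m + 1) * (real n + 1)) * q"
      using assms q by (intro mult_right_mono) (auto simp: algebra_simps)
    also have "\<dots> = (real n + 1) * (2 * (m + 1) * q) / 2" by simp
    also have "\<dots> \<le> (real n + 1) * (real n + 1) / 2"
      using k n by (intro divide_right_mono mult_left_mono) auto
    finally have "(m + real n) * q / (real n + 1)\<^sup>2 \<le> 1 / 2"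
      by (simp add: power2_eq_square divide_le_eq)
    then have "?f (Suc n) \<le> 1 / 2 * ?f n"
      unfolding eq by (intro mult_right_mono f0)
    then show "norm (?f (Suc n)) \<le> 1 / 2 * norm (?f n)"
      using f0[of n] f0[of "Suc n"] by (simp only: real_norm_def abs_of_nonneg)
  qed simp
qed

text \<open>Closed lower half-lines form an intersection-stable generator, so it suffices to compare
  distribution functions; each term of the density integrates over \<open>{0..t}\<close> to an
  incomplete Gamma value.\<close>

lemma (in prob_space) distr_eq_density_gamma_mixture:
  fixes T :: "'a \<Rightarrow> real" and a :: "nat \<Rightarrow> real"
  assumes T [measurable]: "T \<in> borel_measurable M"
    and a: "\<And>n. 0 \<le> a n" "\<And>t. 0 \<le> t \<Longrightarrow> summable (\<lambda>n. a n * lower_inc_gamma (1 + real n) t)"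
    and cdf: "\<And>t. 0 \<le> t \<Longrightarrow> prob {\<omega> \<in> space M. T \<omega> \<le> t} = (\<Sum>n. a n * lower_inc_gamma (1 + real n) t)"
  shows "distr M borel T
    = density lborel (\<lambda>t. \<Sum>n. ennreal (a n * (t ^ n * exp (- t))) * indicator {0..} t)"
    (is "?L = density lborel ?\<phi>")
proof (rule measure_eqI_generator_eq[where E = "range (\<lambda>x::real. {..x})" and \<Omega> = UNIV and A = "\<lambda>i. {..real i}"])
  show "Int_stable (range (\<lambda>x::real. {..x}))" by (auto simp: Int_stable_def)
  show "sets ?L = sigma_sets UNIV (range (\<lambda>x::real. {..x}))"
    "sets (density lborel ?\<phi>) = sigma_sets UNIV (range (\<lambda>x::real. {..x}))"
    by (simp_all add: borel_eq_atMost)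
  show "(\<Union>i. {..real i}) = UNIV" using real_arch_simple by auto
  have emT: "emeasure ?L {..x} = ennreal (prob {\<omega> \<in> space M. T \<omega> \<le> x})" for x
    by (simp add: emeasure_distr emeasure_eq_measure vimage_def Int_def conj_commute)
  then show "emeasure ?L {..real i} \<noteq> \<infinity>" for i by simp
  fix X assume "X \<in> range (\<lambda>x::real. {..x})"
  then obtain x where X: "X = {..x}" by auto
  have dens: "emeasure (density lborel ?\<phi>) {..x}
      = (\<Sum>n. \<integral>\<^sup>+ t. ennreal (a n) * (ennreal (t ^ n * exp (- t)) * indicator {0..x} t) \<partial>lborel)"
  proof -
    have "emeasure (density lborel ?\<phi>) {..x} = (\<integral>\<^sup>+ t. ?\<phi> t * indicator {..x} t \<partial>lborel)"
      by (simp add: emeasure_density)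
    also have "\<dots> = (\<integral>\<^sup>+ t. (\<Sum>n. ennreal (a n) * (ennreal (t ^ n * exp (- t)) * indicator {0..x} t)) \<partial>lborel)"
    proof (rule nn_integral_cong)
      fix t :: real
      show "?\<phi> t * indicator {..x} t = (\<Sum>n. ennreal (a n) * (ennreal (t ^ n * exp (- t)) * indicator {0..x} t))"
        using a(1) by (cases "0 \<le> t \<and> t \<le> x") (auto simp: indicator_def ennreal_mult)
    qed
    also have "\<dots> = (\<Sum>n. \<integral>\<^sup>+ t. ennreal (a n) * (ennreal (t ^ n * exp (- t)) * indicator {0..x} t) \<partial>lborel)"
      by (rule nn_integral_suminf) simp
    finally show ?thesis .
  qed
  show "emeasure ?L X = emeasure (density lborel ?\<phi>) X"
  proof (cases "0 \<le> x")
    case True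
    have "emeasure (density lborel ?\<phi>) {..x} = (\<Sum>n. ennreal (a n * lower_inc_gamma (1 + real n) x))"
      unfolding dens
    proof (rule arg_cong[where f = suminf], rule ext)
      fix n
      have "(\<integral>\<^sup>+ t. ennreal (t ^ n * exp (- t)) * indicator {0..x} t \<partial>lborel) = ennreal (lower_inc_gamma (1 + real n) x)"
        unfolding lower_inc_gamma_Suc_nat[OF True] zero_ereal_def
        by (rule nn_integral_Icc_eq_interval_integral(1)) (use True in \<open>auto intro!: continuous_intros\<close>)
      then show "(\<integral>\<^sup>+ t. ennreal (a n) * (ennreal (t ^ n * exp (- t)) * indicator {0..x} t) \<partial>lborel)
          = ennreal (a n * lower_inc_gamma (1 + real n) x)"
        using a(1) by (simp add: nn_integral_cmult ennreal_mult lower_inc_gamma_nonneg True)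
    qed
    also have "\<dots> = ennreal (\<Sum>n. a n * lower_inc_gamma (1 + real n) x)"
      using a True by (intro suminf_ennreal2) (auto simp: lower_inc_gamma_nonneg)
    finally show ?thesis unfolding X emT cdf[OF True] by simp
  next
    \<comment> \<open>The distribution function is given only on the nonnegative axis. Its value at
      0 is 0, so by monotonicity the negative axis carries no mass.\<close>
    case False
    have "prob {\<omega> \<in> space M. T \<omega> \<le> x} \<le> prob {\<omega> \<in> space M. T \<omega> \<le> 0}"
      using False by (intro finite_measure_mono) auto
    also have "\<dots> = 0" using cdf[of 0] by (simp add: lower_inc_gamma_def zero_ereal_def)
    finally have "emeasure ?L X = 0" unfolding X emT by (simp add: measure_le_0_iff)
    then show ?thesis using False unfolding X dens by simp
  qed
qed auto

text \<open>For \<open>v > 0\<close> and given \<open>T = t\<close>, the event says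
  \<open>max A ((t / v) powr (1 / \<alpha>)) < Y \<le> B\<close>. Its probability is a difference of
  two values of \<open>G\<close> for \<open>t\<close> up to \<open>v * B powr \<alpha>\<close>, and
  0 beyond; it is integrated against the mixture density. Summability is included so that a constant
  factor can later be pulled out of the series.\<close>

lemma (in prob_space) prob_gamma_mixture_less_powr:
  fixes T Y :: "'a \<Rightarrow> real" and a :: "nat \<Rightarrow> real"
  assumes indep: "indep_var borel T borel Y"
    and law: "distr M borel T
      = density lborel (\<lambda>t. \<Sum>n. ennreal (a n * (t ^ n * exp (- t))) * indicator {0..} t)"
    and a: "\<And>n. 0 \<le> a n"
    and AB: "0 < A" "A \<le> B" and v: "0 \<le> v" and \<alpha>: "0 < \<alpha>"
    and G: "continuous_on {A..B} G"
    and tail: "\<And>x. A \<le> x \<Longrightarrow> x \<le> B \<Longrightarrow> prob {\<omega> \<in> space M. x < Y \<omega> \<and> Y \<omega> \<le> B} = G x - G B"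
  shows "prob {\<omega> \<in> space M. T \<omega> < v * Y \<omega> powr \<alpha> \<and> A < Y \<omega> \<and> Y \<omega> \<le> B}
    = (\<Sum>n. a n * ((LBINT t=v * A powr \<alpha>..v * B powr \<alpha>. t ^ n * exp (- t) * G ((t / v) powr (1 / \<alpha>)))
        + G A * lower_inc_gamma (1 + real n) (v * A powr \<alpha>)
        - G B * lower_inc_gamma (1 + real n) (v * B powr \<alpha>)))"
      (is "prob ?E = (\<Sum>n. a n * ?J n)")
    and "summable (\<lambda>n. a n * ((LBINT t=v * A powr \<alpha>..v * B powr \<alpha>. t ^ n * exp (- t) * G ((t / v) powr (1 / \<alpha>)))
        + G A * lower_inc_gamma (1 + real n) (v * A powr \<alpha>)
        - G B * lower_inc_gamma (1 + real n) (v * B powr \<alpha>)))"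
proof -
  have [measurable]: "T \<in> borel_measurable M" "Y \<in> borel_measurable M"
    using indep by (auto dest: indep_var_rv1 indep_var_rv2)
  have "prob ?E = (\<Sum>n. a n * ?J n) \<and> summable (\<lambda>n. a n * ?J n)"
  proof (cases "v = 0")
    \<comment> \<open>For \<open>v = 0\<close> the event lies in \<open>T < 0\<close>, which is null
      because the density vanishes there, and all integrals on the right run over a degenerate
      interval.\<close>
    case True
    have "emeasure M {\<omega> \<in> space M. T \<omega> < 0} = emeasure (distr M borel T) {..<0}"
      by (simp add: emeasure_distr vimage_def Int_def conj_commute)
    also have "\<dots> = 0" unfolding law
      by (simp add: emeasure_density nn_integral_0_iff_AE indicator_def)
    finally have "emeasure M ?E \<le> 0"
      using True emeasure_mono[of ?E "{\<omega> \<in> space M. T \<omega> < 0}" M] by auto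
    moreover have "lower_inc_gamma (1 + real n) 0 = 0" for n
      by (simp add: lower_inc_gamma_def zero_ereal_def)
    ultimately show ?thesis using True by (simp add: measure_def)
  next
    case False
    then have v: "0 < v" using v by simp
    \<comment> \<open>\<open>r\<close> and \<open>\<tau>\<close> are inverse to each other on the
      positive axis, so conditions on \<open>Y\<close> become conditions on \<open>t\<close> with
      thresholds \<open>\<tau> A\<close> and \<open>\<tau> B\<close>.\<close>
    define r where "r t = (t / v) powr (1 / \<alpha>)" for t
    define \<tau> where "\<tau> x = v * x powr \<alpha>" for x
    have r_powr: "r t powr \<alpha> = t / v" if "0 \<le> t" for t
      using that v \<alpha> by (simp add: r_def powr_powr)
    have r_le: "r t \<le> x \<longleftrightarrow> t \<le> \<tau> x" if "0 \<le> t" "0 < x" for t x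
    proof -
      have "r t \<le> x \<longleftrightarrow> r t powr \<alpha> \<le> x powr \<alpha>"
        using that \<alpha> powr_mono2[of \<alpha> "r t" x] powr_less_mono2[of \<alpha> x "r t"]
        by (cases "r t \<le> x") (auto simp: r_def)
      then show ?thesis using v r_powr[OF that(1)] by (simp add: \<tau>_def field_simps)
    qed
    have r_less: "r t < x \<longleftrightarrow> t < \<tau> x" if "0 \<le> t" "0 < x" for t x
    proof -
      have "r t < x \<longleftrightarrow> r t powr \<alpha> < x powr \<alpha>"
        using that \<alpha> powr_mono2[of \<alpha> x "r t"] powr_less_mono2[of \<alpha> "r t" x]
        by (cases "r t < x") (auto simp: r_def)
      then show ?thesis using v r_powr[OF that(1)] by (simp add: \<tau>_def field_simps)
    qed
    have \<tau>: "0 < \<tau> A" "\<tau> A \<le> \<tau> B"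
      using AB v \<alpha> by (auto simp: \<tau>_def intro!: mult_left_mono powr_mono2)
    \<comment> \<open>For \<open>0 \<le> t\<close> and \<open>t \<le> \<tau> B\<close> this is the
      probability of the slice at \<open>t\<close>, whence its nonnegativity. The maximum keeps the
      argument of \<open>G\<close> inside \<open>{A..B}\<close>, where continuity is
      available.\<close>
    define g where "g t = G (max A (r t)) - G B" for t
    have max_r: "A \<le> max A (r t)" "max A (r t) \<le> B" if "0 \<le> t" "t \<le> \<tau> B" for t
      using r_le[of t B] that AB by auto
    have g0: "0 \<le> g t" if "0 \<le> t" "t \<le> \<tau> B" for t
      using tail[OF max_r[OF that]] unfolding g_def by (metis measure_nonneg)
    have cont_r: "continuous_on {0..} r"
      unfolding r_def using v \<alpha> by (intro continuous_intros continuous_on_powr') auto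
    have cont_Gr: "continuous_on {0..\<tau> B} (\<lambda>t. G (max A (r t)))"
      by (rule continuous_on_compose2[OF G])
         (use max_r in \<open>auto intro!: continuous_intros continuous_on_subset[OF cont_r]\<close>)
    have cont_g: "continuous_on {0..\<tau> B} (\<lambda>t. t ^ n * exp (- t) * g t)" for n
      unfolding g_def by (intro continuous_intros cont_Gr)
    define S where "S = {p. fst p < v * snd p powr \<alpha> \<and> A < snd p \<and> snd p \<le> B}"
    have S [measurable]: "S \<in> sets (borel \<Otimes>\<^sub>M borel)"
    proof -
      have "{p \<in> space (borel \<Otimes>\<^sub>M borel). fst p < v * snd p powr \<alpha> \<and> A < snd p \<and> snd p \<le> B}
          \<in> sets (borel \<Otimes>\<^sub>M borel)" by measurable
      then show ?thesis by (simp add: S_def space_pair_measure)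
    qed
    interpret Y: prob_space "distr M borel Y" by (rule prob_space_distr) simp
    have slice: "emeasure (distr M borel Y) (Pair t -` S) = ennreal (g t) * indicator {0..\<tau> B} t"
      if "0 \<le> t" for t
    proof (cases "t \<le> \<tau> B")
      case True
      have "Pair t -` S = {max A (r t)<..B}"
        using AB r_less[OF that] by (auto simp: S_def \<tau>_def)
      then have "emeasure (distr M borel Y) (Pair t -` S) = prob {\<omega> \<in> space M. max A (r t) < Y \<omega> \<and> Y \<omega> \<le> B}"
        by (simp add: emeasure_distr emeasure_eq_measure vimage_def Int_def conj_commute conj_left_commute)
      then show ?thesis using tail[OF max_r[OF that True]] True that by (simp add: g_def)
    next
      case False
      have "x powr \<alpha> \<le> B powr \<alpha>" if "A < x" "x \<le> B" for x
        using that AB \<alpha> by (intro powr_mono2) auto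
      then have "Pair t -` S = {}"
        using False v by (force simp: S_def \<tau>_def not_le dest: mult_left_mono[of _ _ v])
      then show ?thesis using False by simp
    qed
    have term_eq: "(\<integral>\<^sup>+ t. ennreal (a n * (t ^ n * exp (- t))) * indicator {0..} t * emeasure (distr M borel Y) (Pair t -` S) \<partial>lborel)
        = ennreal (a n * ?J n)" and J0: "0 \<le> a n * ?J n" for n
    proof -
      \<comment> \<open>The integral is split at \<open>\<tau> A\<close>: below, the maximum is
        \<open>A\<close> and gives the incomplete Gamma term with \<open>G A\<close>; above, it is
        \<open>r t\<close>. The constant \<open>G B\<close> is subtracted over the whole
        range.\<close>
      have J: "?J n = (LBINT t=0..\<tau> B. t ^ n * exp (- t) * g t)"
      proof -
        have ii: "interval_lebesgue_integrable lborel (ereal x) (ereal y) (\<lambda>t. t ^ n * exp (- t) * f t)"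
          if "continuous_on {x..y} f" "x \<le> y" for f x y
          using that by (intro interval_integrable_continuous_on continuous_intros) auto
        have "(LBINT t=0..\<tau> B. t ^ n * exp (- t) * g t)
            = (LBINT t=0..\<tau> B. t ^ n * exp (- t) * G (max A (r t))) - (LBINT t=0..\<tau> B. t ^ n * exp (- t) * G B)"
          unfolding g_def right_diff_distrib zero_ereal_def
          using \<tau> by (intro interval_lebesgue_integral_diff ii cont_Gr) auto
        also have "(LBINT t=0..\<tau> B. t ^ n * exp (- t) * G B) = G B * lower_inc_gamma (1 + real n) (\<tau> B)"
          using \<tau> by (simp add: lower_inc_gamma_Suc_nat)
        also have "(LBINT t=0..\<tau> B. t ^ n * exp (- t) * G (max A (r t)))
            = (LBINT t=0..\<tau> A. t ^ n * exp (- t) * G (max A (r t)))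
              + (LBINT t=\<tau> A..\<tau> B. t ^ n * exp (- t) * G (max A (r t)))"
        proof (unfold zero_ereal_def, rule interval_integral_sum[symmetric])
          have "min (ereal 0) (min (ereal (\<tau> A)) (ereal (\<tau> B))) = ereal 0"
            "max (ereal 0) (max (ereal (\<tau> A)) (ereal (\<tau> B))) = ereal (\<tau> B)"
            using \<tau> by (auto simp: min_def max_def)
          then show "interval_lebesgue_integrable lborel (min (ereal 0) (min (ereal (\<tau> A)) (ereal (\<tau> B))))
              (max (ereal 0) (max (ereal (\<tau> A)) (ereal (\<tau> B)))) (\<lambda>t. t ^ n * exp (- t) * G (max A (r t)))"
            using \<tau> ii[OF cont_Gr] by simp
        qed
        also have "(LBINT t=0..\<tau> A. t ^ n * exp (- t) * G (max A (r t))) = (LBINT t=0..\<tau> A. t ^ n * exp (- t) * G A)"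
        proof (rule interval_integral_cong)
          fix t assume "t \<in> einterval (min 0 (ereal (\<tau> A))) (max 0 (ereal (\<tau> A)))"
          then have "0 < t" "t < \<tau> A" using \<tau> by (auto simp: einterval_iff max_def min_def)
          then have "max A (r t) = A" using r_less[of t A] AB by simp
          then show "t ^ n * exp (- t) * G (max A (r t)) = t ^ n * exp (- t) * G A" by simp
        qed
        also have "\<dots> = G A * lower_inc_gamma (1 + real n) (\<tau> A)"
          using \<tau> by (simp add: lower_inc_gamma_Suc_nat)
        also have "(LBINT t=\<tau> A..\<tau> B. t ^ n * exp (- t) * G (max A (r t))) = (LBINT t=\<tau> A..\<tau> B. t ^ n * exp (- t) * G (r t))"
        proof (rule interval_integral_cong)
          fix t assume "t \<in> einterval (min (ereal (\<tau> A)) (ereal (\<tau> B))) (max (ereal (\<tau> A)) (ereal (\<tau> B)))"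
          then have "\<tau> A < t" using \<tau> by (auto simp: einterval_iff max_def min_def)
          then have "max A (r t) = r t" using r_le[of t A] \<tau> AB by simp
          then show "t ^ n * exp (- t) * G (max A (r t)) = t ^ n * exp (- t) * G (r t)" by simp
        qed
        finally show ?thesis by (simp add: \<tau>_def r_def)
      qed
      have nn: "(\<integral>\<^sup>+ t. ennreal (t ^ n * exp (- t) * g t) * indicator {0..\<tau> B} t \<partial>lborel) = ennreal (?J n)"
        and J0: "0 \<le> ?J n"
        unfolding J zero_ereal_def
        by (rule nn_integral_Icc_eq_interval_integral; use \<tau> g0 cont_g in auto)+
      show "0 \<le> a n * ?J n" using J0 a by simp
      have "(\<integral>\<^sup>+ t. ennreal (a n * (t ^ n * exp (- t))) * indicator {0..} t * emeasure (distr M borel Y) (Pair t -` S) \<partial>lborel)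
          = (\<integral>\<^sup>+ t. ennreal (a n) * (ennreal (t ^ n * exp (- t) * g t) * indicator {0..\<tau> B} t) \<partial>lborel)"
      proof (rule nn_integral_cong)
        fix t :: real
        show "ennreal (a n * (t ^ n * exp (- t))) * indicator {0..} t * emeasure (distr M borel Y) (Pair t -` S)
            = ennreal (a n) * (ennreal (t ^ n * exp (- t) * g t) * indicator {0..\<tau> B} t)"
          using slice[of t] a g0[of t]
          by (cases "0 \<le> t"; cases "t \<le> \<tau> B") (auto simp: ennreal_mult mult.assoc)
      qed
      also have "\<dots> = ennreal (a n) * (\<integral>\<^sup>+ t. ennreal (t ^ n * exp (- t) * g t) * indicator {0..\<tau> B} t \<partial>lborel)"
      \<comment> \<open>Continuity of the integrand is known only on \<open>{0..\<tau> B}\<close>,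
        so measurability is derived for its product with the indicator.\<close>
      proof (rule nn_integral_cmult)
        have "(\<lambda>t. indicator {0..\<tau> B} t *\<^sub>R (t ^ n * exp (- t) * g t)) \<in> borel_measurable borel"
          by (rule borel_measurable_continuous_on_indicator[OF _ cont_g]) simp
        then have "(\<lambda>t. ennreal (indicator {0..\<tau> B} t *\<^sub>R (t ^ n * exp (- t) * g t))) \<in> borel_measurable lborel"
          by simp
        also have "(\<lambda>t. ennreal (indicator {0..\<tau> B} t *\<^sub>R (t ^ n * exp (- t) * g t)))
            = (\<lambda>t. ennreal (t ^ n * exp (- t) * g t) * indicator {0..\<tau> B} t)"
          by (auto simp: indicator_def)
        finally show "(\<lambda>t. ennreal (t ^ n * exp (- t) * g t) * indicator {0..\<tau> B} t) \<in> borel_measurable lborel" .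
      qed
      finally show "(\<integral>\<^sup>+ t. ennreal (a n * (t ^ n * exp (- t))) * indicator {0..} t * emeasure (distr M borel Y) (Pair t -` S) \<partial>lborel)
        = ennreal (a n * ?J n)"
        unfolding nn using a J0 by (simp add: ennreal_mult)
    qed
    have [measurable]: "(\<lambda>t. emeasure (distr M borel Y) (Pair t -` S)) \<in> borel_measurable borel"
      by (rule Y.measurable_emeasure_Pair) (simp add: sets_pair_measure_cong[OF refl sets_distr])
    have "emeasure M ?E = emeasure (distr M (borel \<Otimes>\<^sub>M borel) (\<lambda>\<omega>. (T \<omega>, Y \<omega>))) S"
      using S by (subst emeasure_distr) (simp_all, auto simp: S_def intro!: arg_cong[where f = "emeasure M"])
    also have "\<dots> = emeasure (distr M borel T \<Otimes>\<^sub>M distr M borel Y) S"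
      using indep by (simp add: indep_var_distribution_eq)
    also have "\<dots> = (\<integral>\<^sup>+ t. emeasure (distr M borel Y) (Pair t -` S) \<partial>distr M borel T)"
      by (rule Y.emeasure_pair_measure_alt) (simp add: sets_pair_measure_cong[OF sets_distr sets_distr])
    also have "\<dots> = (\<integral>\<^sup>+ t. (\<Sum>n. ennreal (a n * (t ^ n * exp (- t))) * indicator {0..} t) * emeasure (distr M borel Y) (Pair t -` S) \<partial>lborel)"
      unfolding law by (rule nn_integral_density) auto
    also have "\<dots> = (\<integral>\<^sup>+ t. (\<Sum>n. ennreal (a n * (t ^ n * exp (- t))) * indicator {0..} t * emeasure (distr M borel Y) (Pair t -` S)) \<partial>lborel)"
      by simp
    also have "\<dots> = (\<Sum>n. \<integral>\<^sup>+ t. ennreal (a n * (t ^ n * exp (- t))) * indicator {0..} t * emeasure (distr M borel Y) (Pair t -` S) \<partial>lborel)"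
      by (rule nn_integral_suminf) simp
    also have "\<dots> = (\<Sum>n. ennreal (a n * ?J n))"
      unfolding term_eq ..
    finally have E: "emeasure M ?E = (\<Sum>n. ennreal (a n * ?J n))" .
    \<comment> \<open>The terms are nonnegative and their extended sum is the measure of an event,
      hence finite.\<close>
    moreover have "summable (\<lambda>n. a n * ?J n)"
      using J0 E by (intro summable_suminf_not_top) auto
    ultimately have "ennreal (prob ?E) = ennreal (\<Sum>n. a n * ?J n)"
      using J0 by (simp add: emeasure_eq_measure suminf_ennreal2)
    then show ?thesis using J0 \<open>summable _\<close> by (simp add: suminf_nonneg)
  qed
  then show "prob ?E = (\<Sum>n. a n * ?J n)" "summable (\<lambda>n. a n * ?J n)" by auto
qed

subsection \<open>The nearest point of a Poisson process on the sphere\<close>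

text \<open>An empty configuration gets the distance \<open>d0\<close>, chosen below to exceed all distances from \<open>u\<close> to
  the sphere, so that \<open>nearest_dist d0 u X \<le> x\<close> says for \<open>x < d0\<close> that \<open>X\<close> has a point within \<open>x\<close>.\<close>
definition nearest_dist :: "real \<Rightarrow> 'a::metric_space \<Rightarrow> 'a set \<Rightarrow> real" where
  "nearest_dist d0 u X = (if X = {} then d0 else Min (dist u ` X))"

lemma nearest_dist_le_iff:
  assumes "finite X" "x < d0"
  shows "nearest_dist d0 u X \<le> x \<longleftrightarrow> (\<exists>s\<in>X. dist u s \<le> x)"
  using assms by (auto simp: nearest_dist_def Min_le_iff)

lemma nearest_dist_le:
  assumes "finite X" "\<And>s. s \<in> X \<Longrightarrow> dist u s \<le> d0"
  shows "nearest_dist d0 u X \<le> d0"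
proof (cases "X = {}")
  case False
  then show ?thesis using assms by (auto simp: nearest_dist_def Min_le_iff)
qed (simp add: nearest_dist_def)

context
  fixes M :: "'w measure" and N :: "'w \<Rightarrow> (real^3) set" and \<rho> lam d0 :: real and u :: "real^3"
  assumes ppp: "sphere_ppp M N \<rho> lam" and d0: "norm u + \<rho> < d0"
begin

interpretation prob_space M
  using ppp unfolding sphere_ppp_def by (elim conjE)

lemma ppp_points: "\<forall>\<omega>\<in>space M. finite (N \<omega>) \<and> N \<omega> \<subseteq> sphere 0 \<rho>"
  using ppp unfolding sphere_ppp_def by (elim conjE)

lemma ppp_counts:
  assumes "A \<in> sets borel" "A \<subseteq> sphere 0 \<rho>"
  shows "(\<lambda>\<omega>. card (N \<omega> \<inter> A)) \<in> measurable M (count_space UNIV)"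
    and "measure M {\<omega> \<in> space M. card (N \<omega> \<inter> A) = k}
      = (lam * sphere_area \<rho> A) ^ k / fact k * exp (- (lam * sphere_area \<rho> A))"
proof -
  have "\<forall>A \<in> sets borel. A \<subseteq> sphere 0 \<rho> \<longrightarrow>
        (\<lambda>\<omega>. card (N \<omega> \<inter> A)) \<in> measurable M (count_space UNIV) \<and>
        (\<forall>k::nat. measure M {\<omega> \<in> space M. card (N \<omega> \<inter> A) = k}
            = (lam * sphere_area \<rho> A) ^ k / fact k * exp (- (lam * sphere_area \<rho> A)))"
    using ppp unfolding sphere_ppp_def by (elim conjE)
  with assms show "(\<lambda>\<omega>. card (N \<omega> \<inter> A)) \<in> measurable M (count_space UNIV)"
    "measure M {\<omega> \<in> space M. card (N \<omega> \<inter> A) = k}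
      = (lam * sphere_area \<rho> A) ^ k / fact k * exp (- (lam * sphere_area \<rho> A))"
    by blast+
qed

lemma ppp_finite: "\<omega> \<in> space M \<Longrightarrow> finite (N \<omega>)"
  using ppp_points by blast

lemma ppp_sphere: "\<omega> \<in> space M \<Longrightarrow> s \<in> N \<omega> \<Longrightarrow> norm s = \<rho>"
  using ppp_points mem_sphere_0 by blast

lemma cap_borel: "{s \<in> sphere 0 \<rho>. dist u s \<le> x} \<in> sets borel"
proof -
  have "{s \<in> sphere 0 \<rho>. dist u s \<le> x} = sphere 0 \<rho> \<inter> cball u x" by auto
  then show ?thesis by (simp add: borel_closed closed_Int)
qed

lemma nearest_dist_greater_iff:
  assumes "\<omega> \<in> space M" "x < d0"
  shows "x < nearest_dist d0 u (N \<omega>) \<longleftrightarrow> card (N \<omega> \<inter> {s \<in> sphere 0 \<rho>. dist u s \<le> x}) = 0"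
proof -
  have "x < nearest_dist d0 u (N \<omega>) \<longleftrightarrow> \<not> (\<exists>s\<in>N \<omega>. dist u s \<le> x)"
    using nearest_dist_le_iff[OF ppp_finite[OF assms(1)] assms(2), of u] by linarith
  also have "\<dots> \<longleftrightarrow> N \<omega> \<inter> {s \<in> sphere 0 \<rho>. dist u s \<le> x} = {}"
    using ppp_sphere[OF assms(1)] by auto
  finally show ?thesis using ppp_finite[OF assms(1)] by simp
qed

lemma nearest_dist_upper:
  assumes "\<omega> \<in> space M"
  shows "nearest_dist d0 u (N \<omega>) \<le> d0"
proof (rule nearest_dist_le[OF ppp_finite[OF assms]])
  fix s assume "s \<in> N \<omega>"
  then have "norm s = \<rho>" by (rule ppp_sphere[OF assms])
  then show "dist u s \<le> d0" using d0 norm_triangle_ineq4[of u s] by (simp add: dist_norm)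
qed

lemma void_event_measurable:
  "{\<omega> \<in> space M. card (N \<omega> \<inter> {s \<in> sphere 0 \<rho>. dist u s \<le> x}) = 0} \<in> sets M"
proof -
  let ?C = "{s \<in> sphere 0 \<rho>. dist u s \<le> x}"
  have "?C \<subseteq> sphere 0 \<rho>" by blast
  from ppp_counts(1)[OF cap_borel this]
  have "(\<lambda>\<omega>. card (N \<omega> \<inter> ?C)) -` {0} \<inter> space M \<in> sets M"
    by (rule measurable_sets) simp
  also have "(\<lambda>\<omega>. card (N \<omega> \<inter> ?C)) -` {0} \<inter> space M = {\<omega> \<in> space M. card (N \<omega> \<inter> ?C) = 0}"
    by blast
  finally show ?thesis .
qed

text \<open>Since \<open>d0\<close> bounds the nearest distance, each such event is the void event
  of a cap or empty. Measurability, law and independence of the nearest distance all rest on this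
  form.\<close>

lemma nearest_dist_greater_event:
  "{\<omega> \<in> space M. x < nearest_dist d0 u (N \<omega>)} =
    (if x < d0 then {\<omega> \<in> space M. card (N \<omega> \<inter> {s \<in> sphere 0 \<rho>. dist u s \<le> x}) = 0} else {})"
proof (cases "x < d0")
  case True
  then show ?thesis using nearest_dist_greater_iff by auto
next
  case False
  then show ?thesis using nearest_dist_upper by force
qed

lemma nearest_dist_measurable: "(\<lambda>\<omega>. nearest_dist d0 u (N \<omega>)) \<in> borel_measurable M"
  unfolding borel_measurable_iff_greater nearest_dist_greater_event using void_event_measurable by simp

lemma prob_nearest_dist_greater:
  assumes "x < d0"
  shows "measure M {\<omega> \<in> space M. x < nearest_dist d0 u (N \<omega>)}
    = exp (- (lam * sphere_area \<rho> {s \<in> sphere 0 \<rho>. dist u s \<le> x}))"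
proof -
  let ?C = "{s \<in> sphere 0 \<rho>. dist u s \<le> x}"
  have "?C \<subseteq> sphere 0 \<rho>" by blast
  from ppp_counts(2)[OF cap_borel this, of 0] show ?thesis
    unfolding nearest_dist_greater_event using assms by simp
qed

text \<open>The assumption speaks only of counts. Void events of caps are preimages of open upper
  half-lines under the nearest distance; these are intersection-stable and generate its
  sigma-algebra, so independence extends to all of it.\<close>

lemma indep_var_nearest_dist:
  assumes h: "h \<in> borel_measurable M" and indep: "indep_of_ppp M h N \<rho>"
  shows "indep_var borel h borel (\<lambda>\<omega>. nearest_dist d0 u (N \<omega>))"
proof -
  let ?Y = "\<lambda>\<omega>. nearest_dist d0 u (N \<omega>)"
  let ?H = "{h -` A \<inter> space M |A. A \<in> sets borel}"
  let ?E = "{?Y -` A \<inter> space M |A. A \<in> range (\<lambda>x. {x<..})}"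
  have "indep_set ?H ?E"
  proof (rule indep_setI)
    show "?H \<subseteq> events" using h by (auto intro: measurable_sets)
    show "?E \<subseteq> events" using nearest_dist_measurable by (auto intro!: measurable_sets)
    fix A E assume "A \<in> ?H" "E \<in> ?E"
    then obtain B x where B: "B \<in> sets borel" "A = {\<omega> \<in> space M. h \<omega> \<in> B}"
      and E: "E = {\<omega> \<in> space M. x < ?Y \<omega>}"
      by (auto simp: vimage_def Int_def conj_commute)
    show "prob (A \<inter> E) = prob A * prob E"
    proof (cases "x < d0")
      case True
      let ?C = "{s \<in> sphere 0 \<rho>. dist u s \<le> x}"
      have C: "?C \<subseteq> sphere 0 \<rho>" by blast
      \<comment> \<open>Independence from the process is used for a one-element family, the cap,
        with count 0.\<close>
      have "measure M {\<omega>\<in>space M. h \<omega> \<in> B \<and> (\<forall>i\<in>{0::nat}. card (N \<omega> \<inter> ?C) = 0)}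
         = measure M {\<omega>\<in>space M. h \<omega> \<in> B} * measure M {\<omega>\<in>space M. \<forall>i\<in>{0::nat}. card (N \<omega> \<inter> ?C) = 0}"
        using indep[unfolded indep_of_ppp_def, rule_format, of "{0}" "\<lambda>_. ?C" B "\<lambda>_. 0"] B(1) cap_borel C
        by blast
      moreover have "A \<inter> E = {\<omega>\<in>space M. h \<omega> \<in> B \<and> (\<forall>i\<in>{0::nat}. card (N \<omega> \<inter> ?C) = 0)}"
        unfolding B E nearest_dist_greater_event using True by auto
      moreover have "E = {\<omega>\<in>space M. \<forall>i\<in>{0::nat}. card (N \<omega> \<inter> ?C) = 0}"
        unfolding E nearest_dist_greater_event using True by simp
      ultimately show ?thesis unfolding B by simp
    next
      case False
      then show ?thesis unfolding E nearest_dist_greater_event by simp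
    qed
  qed
  moreover have "Int_stable ?H"
  proof (rule Int_stableI)
    fix a b assume "a \<in> ?H" "b \<in> ?H"
    then obtain A B where "a = h -` A \<inter> space M" "b = h -` B \<inter> space M" "A \<in> sets borel" "B \<in> sets borel"
      by blast
    then have "a \<inter> b = h -` (A \<inter> B) \<inter> space M" "A \<inter> B \<in> sets borel" by auto
    then show "a \<inter> b \<in> ?H" by blast
  qed
  moreover have "Int_stable ?E"
  proof (rule Int_stableI)
    fix a b assume "a \<in> ?E" "b \<in> ?E"
    then obtain x y where "a = ?Y -` {x<..} \<inter> space M" "b = ?Y -` {y<..} \<inter> space M" by auto
    then have "a \<inter> b = ?Y -` {max x y<..} \<inter> space M" by auto
    then show "a \<inter> b \<in> ?E" by blast
  qed
  ultimately have "indep_set (sigma_sets (space M) ?H) (sigma_sets (space M) ?E)"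
    by (rule indep_set_sigma_sets)
  moreover have "sigma_sets (space M) ?E = {?Y -` A \<inter> space M |A. A \<in> sigma_sets UNIV (range (\<lambda>x. {x<..}))}"
    by (rule sigma_sets_vimage_commute[symmetric]) auto
  moreover have "sigma_sets UNIV (range (\<lambda>x::real. {x<..})) = sets borel"
    by (simp add: borel_Ioi)
  moreover have "sigma_sets (space M) {?Y -` A \<inter> space M |A. A \<in> sets borel} = {?Y -` A \<inter> space M |A. A \<in> sets borel}"
    using sigma_sets_vimage_commute[of ?Y "space M" UNIV "sets borel", symmetric]
    unfolding sets.sigma_sets_eq[of borel, unfolded space_borel] by simp
  ultimately show ?thesis
    unfolding indep_var_eq using h nearest_dist_measurable by simp
qed

end

subsection \<open>The outage probability\<close>

text \<open>Nonnegativity of \<open>z\<close> keeps the argument of the logarithm positive, so the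
  rate condition can be inverted. The factor in front of \<open>y powr \<alpha>\<close> is the
  origin of \<open>w1\<close> and \<open>w2\<close>.\<close>

lemma outage_iff:
  fixes \<kappa> y z \<alpha> R :: real
  assumes "\<kappa> > 0" "y > 0" "z \<ge> 0"
  shows "log 2 (1 + \<kappa> * z * y powr (- \<alpha>)) < R \<longleftrightarrow> z < (2 powr R - 1) / \<kappa> * y powr \<alpha>"
proof -
  have "log 2 (1 + \<kappa> * z * y powr (- \<alpha>)) < R \<longleftrightarrow> \<kappa> * z * y powr (- \<alpha>) < 2 powr R - 1"
    using assms by (subst log_less_iff) (auto intro!: add_pos_nonneg)
  then show ?thesis using assms by (simp add: powr_minus field_simps)
qed

text \<open>Treats one range of distances with constant antenna gain: from \<open>a\<close> to
  \<open>dth\<close> for the main lobe and from \<open>dth\<close> to \<open>dmax\<close> for the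
  side lobes. All link factors other than fading and distance are collected in
  \<open>\<kappa>\<close>.\<close>

lemma (in prob_space) prob_outage_segment:
  fixes h Y :: "'a \<Rightarrow> real" and \<alpha> R :: real
  assumes indep: "indep_var borel h borel Y"
    and h_cdf: "\<And>x. 0 \<le> x \<Longrightarrow> prob {\<omega> \<in> space M. h \<omega> \<le> x} = SR_cdf b m \<Omega> x"
    and pos: "b > 0" "m > 0" "\<Omega> > 0" "\<kappa> > 0" "\<alpha> > 0" "R \<ge> 0"
    and AB: "0 < A" "A \<le> B"
    and tail: "\<And>x. A \<le> x \<Longrightarrow> x \<le> B \<Longrightarrow> prob {\<omega> \<in> space M. x < Y \<omega>} = exp (- \<beta> * (x\<^sup>2 - a\<^sup>2))"
  defines "w \<equiv> (2 powr R - 1) / \<kappa>"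
  shows "prob {\<omega> \<in> space M. log 2 (1 + \<kappa> * h \<omega> * Y \<omega> powr (- \<alpha>)) < R \<and> A < Y \<omega> \<and> Y \<omega> \<le> B}
    = SR_K b m \<Omega> * (\<Sum>n. SR_c b m \<Omega> n * (exp (\<beta> * a\<^sup>2)
          * (LBINT t = w * A powr \<alpha> / (2*b) .. w * B powr \<alpha> / (2*b). t ^ n * exp (- t - \<beta> * (2*b*t / w) powr (2 / \<alpha>)))
        + exp (- \<beta> * (A\<^sup>2 - a\<^sup>2)) * lower_inc_gamma (1 + real n) (w * A powr \<alpha> / (2*b))
        - exp (- \<beta> * (B\<^sup>2 - a\<^sup>2)) * lower_inc_gamma (1 + real n) (w * B powr \<alpha> / (2*b))))"
    (is "_ = ?K * (\<Sum>n. ?c n * ?J n)")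
proof -
  have [measurable]: "h \<in> borel_measurable M" "Y \<in> borel_measurable M"
    using indep by (auto dest: indep_var_rv1 indep_var_rv2)
  \<comment> \<open>Rescaling by \<open>2 * b\<close> turns the terms of the CDF into incomplete
    Gamma values at the argument itself.\<close>
  define T where "T \<omega> = h \<omega> / (2 * b)" for \<omega>
  have [measurable]: "T \<in> borel_measurable M" by (simp add: T_def[abs_def])
  have "0 < 2 * b * m + \<Omega>" using pos by (intro add_pos_pos mult_pos_pos) auto
  then have K: "0 < ?K" using pos by (simp add: SR_K_def)
  have c: "0 \<le> ?c n" for n using pos by (intro SR_c_nonneg)
  have summ: "summable (\<lambda>n. ?c n * lower_inc_gamma (1 + real n) t)" if "0 \<le> t" for t
    using SR_c_summable[OF pos(1-3) that]
    by (rule summable_comparison_test')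
       (use c that lower_inc_gamma_nonneg lower_inc_gamma_le_power in
         \<open>auto simp: abs_mult simp del: power_Suc intro!: mult_left_mono\<close>)
  have indepT: "indep_var borel T borel Y"
  proof -
    have "indep_var borel ((\<lambda>x. x / (2 * b)) \<circ> h) borel ((\<lambda>x. x) \<circ> Y)"
      by (rule indep_var_compose[OF indep]) auto
    moreover have "(\<lambda>x. x / (2 * b)) \<circ> h = T" by (auto simp: T_def fun_eq_iff)
    moreover have "(\<lambda>x. x) \<circ> Y = Y" by auto
    ultimately show ?thesis by (simp only:)
  qed
  have law: "distr M borel T
      = density lborel (\<lambda>t. \<Sum>n. ennreal (?K * ?c n * (t ^ n * exp (- t))) * indicator {0..} t)"
  proof (rule distr_eq_density_gamma_mixture)
    fix t :: real assume t: "0 \<le> t"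
    show "summable (\<lambda>n. ?K * ?c n * lower_inc_gamma (1 + real n) t)"
      using summable_mult[OF summ[OF t], of ?K] by (simp add: mult.assoc)
    have "{\<omega> \<in> space M. T \<omega> \<le> t} = {\<omega> \<in> space M. h \<omega> \<le> 2 * b * t}"
      using pos by (auto simp: T_def field_simps)
    then show "prob {\<omega> \<in> space M. T \<omega> \<le> t} = (\<Sum>n. ?K * ?c n * lower_inc_gamma (1 + real n) t)"
      using h_cdf[of "2 * b * t"] t pos suminf_mult[OF summ[OF t], of ?K]
      by (simp add: SR_cdf_def mult.assoc)
  qed (use K c in auto)
  \<comment> \<open>Every term of the CDF vanishes at 0, so \<open>h\<close> is almost surely
    positive.\<close>
  have h_nonneg: "AE \<omega> in M. 0 \<le> h \<omega>"
  proof -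
    have "prob {\<omega> \<in> space M. h \<omega> \<le> 0} = 0"
      using h_cdf[of 0] by (simp add: SR_cdf_def lower_inc_gamma_def zero_ereal_def)
    then have "AE \<omega> in M. \<not> h \<omega> \<le> 0"
      by (subst (asm) prob_eq_0) auto
    then show ?thesis by eventually_elim simp
  qed
  define v where "v = w / (2 * b)"
  define G where "G x = exp (- \<beta> * (x\<^sup>2 - a\<^sup>2))" for x
  have v: "0 \<le> v" using pos ge_one_powr_ge_zero[of 2 R] by (simp add: v_def w_def)
  have tail': "prob {\<omega> \<in> space M. x < Y \<omega> \<and> Y \<omega> \<le> B} = G x - G B" if "A \<le> x" "x \<le> B" for x
  proof -
    have "{\<omega> \<in> space M. x < Y \<omega> \<and> Y \<omega> \<le> B} = {\<omega> \<in> space M. x < Y \<omega>} - {\<omega> \<in> space M. B < Y \<omega>}" by auto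
    also have "prob \<dots> = prob {\<omega> \<in> space M. x < Y \<omega>} - prob {\<omega> \<in> space M. B < Y \<omega>}"
      using that by (intro finite_measure_Diff) auto
    finally show ?thesis using tail that AB by (simp add: G_def)
  qed
  have contG: "continuous_on {A..B} G" unfolding G_def by (intro continuous_intros)
  note main = prob_gamma_mixture_less_powr[OF indepT law _ AB v pos(5) contG tail']
  \<comment> \<open>The factor \<open>exp (\<beta> * a^2)\<close> is split off from
    \<open>G\<close>, and squaring \<open>powr (1 / \<alpha>)\<close> gives the exponent
    \<open>2 / \<alpha>\<close>.\<close>
  have J: "(LBINT t=v * A powr \<alpha>..v * B powr \<alpha>. t ^ n * exp (- t) * G ((t / v) powr (1 / \<alpha>)))
        + G A * lower_inc_gamma (1 + real n) (v * A powr \<alpha>)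
        - G B * lower_inc_gamma (1 + real n) (v * B powr \<alpha>) = ?J n" for n
  proof -
    have eq: "t ^ n * exp (- t) * G ((t / v) powr (1 / \<alpha>))
        = exp (\<beta> * a\<^sup>2) * (t ^ n * exp (- t - \<beta> * (2*b*t / w) powr (2 / \<alpha>)))" for t
    proof -
      have "((t / v) powr (1 / \<alpha>))\<^sup>2 = (2*b*t / w) powr (2 / \<alpha>)"
        by (simp add: power2_eq_square v_def mult_ac flip: powr_add)
      then show ?thesis by (simp add: G_def algebra_simps flip: exp_add)
    qed
    show ?thesis unfolding eq by (simp add: G_def v_def)
  qed
  \<comment> \<open>The two events may differ where \<open>h\<close> is negative, so they are
    compared only up to a null set.\<close>
  have "prob {\<omega> \<in> space M. log 2 (1 + \<kappa> * h \<omega> * Y \<omega> powr (- \<alpha>)) < R \<and> A < Y \<omega> \<and> Y \<omega> \<le> B}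
      = prob {\<omega> \<in> space M. T \<omega> < v * Y \<omega> powr \<alpha> \<and> A < Y \<omega> \<and> Y \<omega> \<le> B}"
  proof (rule finite_measure_eq_AE)
    show "AE \<omega> in M. \<omega> \<in> {\<omega> \<in> space M. log 2 (1 + \<kappa> * h \<omega> * Y \<omega> powr (- \<alpha>)) < R \<and> A < Y \<omega> \<and> Y \<omega> \<le> B}
        \<longleftrightarrow> \<omega> \<in> {\<omega> \<in> space M. T \<omega> < v * Y \<omega> powr \<alpha> \<and> A < Y \<omega> \<and> Y \<omega> \<le> B}"
      using h_nonneg
    proof eventually_elim
      case (elim \<omega>)
      have "log 2 (1 + \<kappa> * h \<omega> * Y \<omega> powr (- \<alpha>)) < R \<longleftrightarrow> T \<omega> < v * Y \<omega> powr \<alpha>" if "A < Y \<omega>"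
      proof -
        have "log 2 (1 + \<kappa> * h \<omega> * Y \<omega> powr (- \<alpha>)) < R \<longleftrightarrow> h \<omega> < w * Y \<omega> powr \<alpha>"
          unfolding w_def using elim that AB pos by (intro outage_iff) auto
        also have "\<dots> \<longleftrightarrow> h \<omega> / (2 * b) < w * Y \<omega> powr \<alpha> / (2 * b)"
          using divide_less_cancel[of "h \<omega>" "2 * b" "w * Y \<omega> powr \<alpha>"] pos by linarith
        finally show ?thesis by (simp add: T_def v_def)
      qed
      then show ?case by auto
    qed
  qed measurable
  also have "\<dots> = (\<Sum>n. ?K * ?c n * ?J n)"
    using main(1) K c unfolding J by simp
  also have "\<dots> = ?K * (\<Sum>n. ?c n * ?J n)"
  proof -
    have "summable (\<lambda>n. ?K * ?c n * ?J n)" using main(2) K c unfolding J by simp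
    from summable_mult[OF this, of "inverse ?K"] have "summable (\<lambda>n. ?c n * ?J n)"
      using K by (simp add: mult.assoc[symmetric])
    from suminf_mult[OF this, of ?K] show ?thesis by (simp add: mult.assoc)
  qed
  finally show ?thesis .
qed

theorem theorem2:
  fixes M :: "'w measure" and N :: "'w \<Rightarrow> (real^3) set" and h :: "'w \<Rightarrow> real"
    and u :: "real^3"
    and r\<^sub>e a S \<theta>min \<omega>th b m \<Omega> P g Gtml Gtsl Gr N0 W fc c \<alpha> R :: real
  defines "dmax \<equiv> sqrt (r\<^sub>e^2 * (sin \<theta>min)^2 + a^2 + 2*r\<^sub>e*a) - r\<^sub>e * sin \<theta>min"
      and "\<psi>th \<equiv> arcsin ((r\<^sub>e + a) / r\<^sub>e * sin \<omega>th) - \<omega>th"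
  defines "dth \<equiv> sqrt (r\<^sub>e^2 + (r\<^sub>e + a)^2 - 2*r\<^sub>e*(r\<^sub>e + a) * cos \<psi>th)"
      and "D \<equiv> (\<lambda>\<omega>. Min (dist u ` N \<omega>))"
  defines "snr \<equiv> (\<lambda>\<omega>. P * g * (if D \<omega> \<le> dth then Gtml else Gtsl) * Gr * h \<omega>
                    * (c / (4*pi*fc))^2 * D \<omega> powr (- \<alpha>) / (N0 * W))"
  defines "Pserml \<equiv> \<P>(\<omega> in M. \<exists>s\<in>N \<omega>. dist u s \<le> dth)"
      and "Psersl \<equiv> \<P>(\<omega> in M. \<not> (\<exists>s\<in>N \<omega>. dist u s \<le> dth)
                          \<and> (\<exists>s\<in>N \<omega>. dth < dist u s \<and> dist u s \<le> dmax))"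
      and "Pinv \<equiv> \<P>(\<omega> in M. \<not> (\<exists>s\<in>N \<omega>. dist u s \<le> dmax))"
      and "Pout \<equiv> cond_prob M (\<lambda>\<omega>. log 2 (1 + snr \<omega>) < R)
                     (\<lambda>\<omega>. N \<omega> \<noteq> {} \<and> D \<omega> \<le> dmax)"
      and "Poutml \<equiv> cond_prob M (\<lambda>\<omega>. log 2 (1 + snr \<omega>) < R)
                     (\<lambda>\<omega>. N \<omega> \<noteq> {} \<and> D \<omega> \<le> dth)"
      and "Poutsl \<equiv> cond_prob M (\<lambda>\<omega>. log 2 (1 + snr \<omega>) < R)
                     (\<lambda>\<omega>. N \<omega> \<noteq> {} \<and> dth < D \<omega> \<and> D \<omega> \<le> dmax)"
  defines "\<beta>S \<equiv> S / (4 * r\<^sub>e * (r\<^sub>e + a))"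
  defines "FD \<equiv> (\<lambda>x. 1 - exp (- \<beta>S * (x^2 - a^2)))"
      and "w1 \<equiv> 16 * pi^2 * fc^2 * N0 * W * (2 powr R - 1) / (P * g * c^2 * Gtml * Gr)"
      and "w2 \<equiv> 16 * pi^2 * fc^2 * N0 * W * (2 powr R - 1) / (P * g * c^2 * Gtsl * Gr)"
      and "K \<equiv> SR_K b m \<Omega>"
      and "cc \<equiv> SR_c b m \<Omega>"
  defines "Cml \<equiv> (\<lambda>n::nat. LBINT t = w1 * a powr \<alpha> / (2*b) .. w1 * dth powr \<alpha> / (2*b).
                    t ^ n * exp (- t - \<beta>S * (2*b*t / w1) powr (2 / \<alpha>)))"
      and "Csl \<equiv> (\<lambda>n::nat. LBINT t = w2 * dth powr \<alpha> / (2*b) .. w2 * dmax powr \<alpha> / (2*b).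
                    t ^ n * exp (- t - \<beta>S * (2*b*t / w2) powr (2 / \<alpha>)))"
  assumes "r\<^sub>e > 0" and "a > 0" and "S > 0"
      and "\<theta>min > 0" and "\<omega>th > 0"
      and "a < dth" and "dth \<le> dmax"
      and "b > 0" and "m > 0" and "\<Omega> > 0"
      and "P > 0" and "g > 0" and "Gtml > 0" and "Gtsl > 0" and "Gr > 0"
      and "N0 > 0" and "W > 0" and "fc > 0" and "c > 0" and "\<alpha> > 0" and "R \<ge> 0"
      and "norm u = r\<^sub>e"
      and ppp: "sphere_ppp M N (r\<^sub>e + a) (S / (4 * pi * (r\<^sub>e + a)^2))"
      and h_rv: "h \<in> borel_measurable M"
      and h_cdf: "\<forall>x\<ge>0. \<P>(\<omega> in M. h \<omega> \<le> x) = SR_cdf b m \<Omega> x"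
      and h_indep: "indep_of_ppp M h N (r\<^sub>e + a)"
  shows "Pout = Pserml / (1 - Pinv) * Poutml + Psersl / (1 - Pinv) * Poutsl
       \<and> Poutml = K / FD dth * (\<Sum>n. cc n * (exp (\<beta>S * a^2) * Cml n
              + lower_inc_gamma (1 + real n) (w1 * a powr \<alpha> / (2*b))
              - exp (- \<beta>S * (dth^2 - a^2)) * lower_inc_gamma (1 + real n) (w1 * dth powr \<alpha> / (2*b))))
       \<and> Poutsl = K / (FD dmax - FD dth) * (\<Sum>n. cc n * (exp (\<beta>S * a^2) * Csl n
              + exp (- \<beta>S * (dth^2 - a^2)) * lower_inc_gamma (1 + real n) (w2 * dth powr \<alpha> / (2*b))
              - exp (- \<beta>S * (dmax^2 - a^2)) * lower_inc_gamma (1 + real n) (w2 * dmax powr \<alpha> / (2*b))))"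
proof -
  note pos = \<open>r\<^sub>e > 0\<close> \<open>a > 0\<close> \<open>S > 0\<close>
  define \<rho> where "\<rho> = r\<^sub>e + a"
  \<comment> \<open>No point of the sphere is farther from \<open>u\<close> than
    \<open>r\<^sub>e + \<rho>\<close>. The extra 1 makes the default distance of an empty
    configuration strictly larger, in particular larger than \<open>dmax\<close>.\<close>
  define d0 where "d0 = r\<^sub>e + \<rho> + 1"
  define Y where "Y \<omega> = nearest_dist d0 u (N \<omega>)" for \<omega>
  interpret prob_space M using ppp unfolding sphere_ppp_def by (elim conjE)
  have ppp': "sphere_ppp M N \<rho> (S / (4 * pi * \<rho>\<^sup>2))" and indep': "indep_of_ppp M h N \<rho>"
    using ppp h_indep by (simp_all add: \<rho>_def)
  have d0: "norm u + \<rho> < d0" using \<open>norm u = r\<^sub>e\<close> by (simp add: d0_def)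
  have \<rho>: "\<rho> > 0" "\<rho> - norm u = a" using pos \<open>norm u = r\<^sub>e\<close> by (auto simp: \<rho>_def)

  \<comment> \<open>Range of the distances\<close>
  have dmax: "dmax \<le> \<rho> + r\<^sub>e"
  proof -
    \<comment> \<open>A squared sine is at most 1, which bounds the root by \<open>\<rho>\<close>;
      the subtracted sine term contributes at most \<open>r\<^sub>e\<close>.\<close>
    have s: "\<bar>r\<^sub>e * sin \<theta>min\<bar> \<le> r\<^sub>e"
      using pos mult_left_mono[of "\<bar>sin \<theta>min\<bar>" 1 "r\<^sub>e"] by (simp add: abs_mult)
    then have "(r\<^sub>e * sin \<theta>min)\<^sup>2 \<le> r\<^sub>e\<^sup>2" using pos by (simp add: abs_le_square_iff[symmetric])
    then have "r\<^sub>e^2 * (sin \<theta>min)^2 + a^2 + 2*r\<^sub>e*a \<le> \<rho>\<^sup>2"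
      by (simp add: \<rho>_def power2_sum power_mult_distrib algebra_simps)
    then have "sqrt (r\<^sub>e^2 * (sin \<theta>min)^2 + a^2 + 2*r\<^sub>e*a) \<le> \<rho>"
      using \<rho> by (intro real_le_lsqrt) auto
    then show ?thesis using s unfolding dmax_def by linarith
  qed
  have dist: "a < dth" "dth \<le> dmax" "dmax < d0" "dth < d0" "0 < dmax"
    using \<open>a < dth\<close> \<open>dth \<le> dmax\<close> dmax pos by (auto simp: d0_def)

  \<comment> \<open>Law of the nearest distance\<close>
  have Y_meas [measurable]: "Y \<in> borel_measurable M"
    unfolding Y_def using nearest_dist_measurable[OF ppp' d0] .
  have hY: "indep_var borel h borel Y"
    unfolding Y_def using indep_var_nearest_dist[OF ppp' d0 h_rv indep'] .
  have [measurable]: "h \<in> borel_measurable M" by (rule h_rv)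
  have tail: "prob {\<omega> \<in> space M. x < Y \<omega>} = exp (- \<beta>S * (x\<^sup>2 - a\<^sup>2))" if "a \<le> x" "x \<le> dmax" for x
  proof -
    have "sphere_area \<rho> {s \<in> sphere 0 \<rho>. dist u s \<le> x} = pi * \<rho> * (x\<^sup>2 - a\<^sup>2) / r\<^sub>e"
      using sphere_area_cap[of u \<rho> x] \<rho> that pos dmax \<open>norm u = r\<^sub>e\<close> by simp
    \<comment> \<open>Intensity times cap area is the mean number of satellites in the cap, which
      explains the form of \<open>\<beta>S\<close>.\<close>
    moreover have "S / (4 * pi * \<rho>\<^sup>2) * (pi * \<rho> * (x\<^sup>2 - a\<^sup>2) / r\<^sub>e) = \<beta>S * (x\<^sup>2 - a\<^sup>2)"
      using \<rho> pos by (simp add: \<beta>S_def power2_eq_square flip: \<rho>_def)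
    ultimately show ?thesis
      unfolding Y_def using prob_nearest_dist_greater[OF ppp' d0, of x] that dist by simp
  qed
  have below: "prob {\<omega> \<in> space M. Y \<omega> \<le> x} = FD x" if "a \<le> x" "x \<le> dmax" for x
  proof -
    have "prob (space M - {\<omega> \<in> space M. x < Y \<omega>}) = 1 - prob {\<omega> \<in> space M. x < Y \<omega>}"
      by (intro prob_compl) simp
    moreover have "space M - {\<omega> \<in> space M. x < Y \<omega>} = {\<omega> \<in> space M. Y \<omega> \<le> x}" by auto
    ultimately show ?thesis using tail[OF that] by (simp add: FD_def)
  qed
  have between: "prob {\<omega> \<in> space M. x < Y \<omega> \<and> Y \<omega> \<le> y} = FD y - FD x"
    if "a \<le> x" "x \<le> y" "y \<le> dmax" for x y
  proof -
    have "{\<omega> \<in> space M. x < Y \<omega> \<and> Y \<omega> \<le> y} = {\<omega> \<in> space M. Y \<omega> \<le> y} - {\<omega> \<in> space M. Y \<omega> \<le> x}" by auto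
    also have "prob \<dots> = prob {\<omega> \<in> space M. Y \<omega> \<le> y} - prob {\<omega> \<in> space M. Y \<omega> \<le> x}"
      using that by (intro finite_measure_Diff) auto
    finally show ?thesis using below that by simp
  qed
  \<comment> \<open>Distance \<open>a\<close> is the smallest possible one, attained only at the
    point of the sphere above the terminal.\<close>
  have Y_gt_a: "AE \<omega> in M. a < Y \<omega>"
  proof -
    have "prob {\<omega> \<in> space M. Y \<omega> \<le> a} = 0" using below[of a] dist by (simp add: FD_def)
    then have "AE \<omega> in M. \<not> Y \<omega> \<le> a" by (subst (asm) prob_eq_0) auto
    then show ?thesis by eventually_elim simp
  qed

  \<comment> \<open>Events expressed through the nearest distance\<close>
  have D_Y: "D \<omega> = Y \<omega>" if "N \<omega> \<noteq> {}" for \<omega>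
    using that by (simp add: Y_def D_def nearest_dist_def)
  \<comment> \<open>An empty configuration has \<open>Y \<omega> = d0\<close>, beyond
    \<open>dmax\<close>. The bound thus excludes the case in which \<open>D\<close> is a minimum
    over the empty set.\<close>
  have Y_visible: "N \<omega> \<noteq> {}" if "Y \<omega> \<le> dmax" for \<omega>
    using that dist by (auto simp: Y_def nearest_dist_def)
  have near: "(\<exists>s\<in>N \<omega>. dist u s \<le> x) \<longleftrightarrow> Y \<omega> \<le> x" if "\<omega> \<in> space M" "x < d0" for \<omega> x
    unfolding Y_def using nearest_dist_le_iff[OF ppp_finite[OF ppp' d0 that(1)] that(2)] by simp

  \<comment> \<open>Outage and service probabilities\<close>
  define \<kappa> where "\<kappa> Gt = P * g * Gt * Gr * (c / (4*pi*fc))^2 / (N0 * W)" for Gt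
  define out where "out Gt \<omega> \<longleftrightarrow> log 2 (1 + \<kappa> Gt * h \<omega> * Y \<omega> powr (- \<alpha>)) < R" for Gt \<omega>
  have [measurable]: "Measurable.pred M (out Gt)" for Gt unfolding out_def by measurable
  have snr_Y: "snr \<omega> = \<kappa> (if Y \<omega> \<le> dth then Gtml else Gtsl) * h \<omega> * Y \<omega> powr (- \<alpha>)" if "N \<omega> \<noteq> {}" for \<omega>
    using D_Y[OF that] by (simp add: snr_def \<kappa>_def)
  have Pout_ml: "{\<omega> \<in> space M. log 2 (1 + snr \<omega>) < R \<and> N \<omega> \<noteq> {} \<and> D \<omega> \<le> dth}
      = {\<omega> \<in> space M. out Gtml \<omega> \<and> Y \<omega> \<le> dth}" (is "?Oml = ?Oml'")
    using D_Y Y_visible snr_Y dist by (fastforce simp: out_def)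
  have Pout_sl: "{\<omega> \<in> space M. log 2 (1 + snr \<omega>) < R \<and> N \<omega> \<noteq> {} \<and> dth < D \<omega> \<and> D \<omega> \<le> dmax}
      = {\<omega> \<in> space M. out Gtsl \<omega> \<and> dth < Y \<omega> \<and> Y \<omega> \<le> dmax}" (is "?Osl = ?Osl'")
    using D_Y Y_visible snr_Y dist by (fastforce simp: out_def)
  have Pout_all: "{\<omega> \<in> space M. log 2 (1 + snr \<omega>) < R \<and> N \<omega> \<noteq> {} \<and> D \<omega> \<le> dmax} = ?Oml \<union> ?Osl"
    using dist by auto
  have ml: "Poutml = prob ?Oml' / FD dth"
  proof -
    have "{\<omega> \<in> space M. N \<omega> \<noteq> {} \<and> D \<omega> \<le> dth} = {\<omega> \<in> space M. Y \<omega> \<le> dth}"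
      using D_Y Y_visible dist by fastforce
    then show ?thesis unfolding Poutml_def cond_prob_def Pout_ml using below[of dth] dist by simp
  qed
  have sl: "Poutsl = prob ?Osl' / (FD dmax - FD dth)"
  proof -
    have "{\<omega> \<in> space M. N \<omega> \<noteq> {} \<and> dth < D \<omega> \<and> D \<omega> \<le> dmax} = {\<omega> \<in> space M. dth < Y \<omega> \<and> Y \<omega> \<le> dmax}"
      using D_Y Y_visible dist by fastforce
    then show ?thesis unfolding Poutsl_def cond_prob_def Pout_sl using between[of dth dmax] dist by simp
  qed
  have all: "Pout = (prob ?Oml' + prob ?Osl') / FD dmax"
  proof -
    have "{\<omega> \<in> space M. N \<omega> \<noteq> {} \<and> D \<omega> \<le> dmax} = {\<omega> \<in> space M. Y \<omega> \<le> dmax}"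
      using D_Y Y_visible dist by fastforce
    moreover have "prob (?Oml' \<union> ?Osl') = prob ?Oml' + prob ?Osl'"
      by (intro finite_measure_Union) auto
    ultimately show ?thesis
      unfolding Pout_def cond_prob_def Pout_all Pout_ml Pout_sl using below[of dmax] dist by simp
  qed
  have serml: "Pserml = FD dth"
  proof -
    have "{\<omega> \<in> space M. \<exists>s\<in>N \<omega>. dist u s \<le> dth} = {\<omega> \<in> space M. Y \<omega> \<le> dth}"
      by (rule Collect_cong, rule conj_cong[OF refl]) (simp add: near dist)
    then show ?thesis unfolding Pserml_def using below[of dth] dist by simp
  qed
  have inv: "Pinv = 1 - FD dmax"
  proof -
    have "{\<omega> \<in> space M. \<not> (\<exists>s\<in>N \<omega>. dist u s \<le> dmax)} = {\<omega> \<in> space M. dmax < Y \<omega>}"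
      by (rule Collect_cong, rule conj_cong[OF refl]) (simp add: near dist not_le)
    then show ?thesis unfolding Pinv_def using tail[of dmax] dist by (simp add: FD_def)
  qed
  have sersl: "Psersl = FD dmax - FD dth"
  proof -
    \<comment> \<open>Once no satellite is within \<open>dth\<close>, the lower bound on the
      distance in the second clause is automatic.\<close>
    have "{\<omega> \<in> space M. \<not> (\<exists>s\<in>N \<omega>. dist u s \<le> dth) \<and> (\<exists>s\<in>N \<omega>. dth < dist u s \<and> dist u s \<le> dmax)}
        = {\<omega> \<in> space M. \<not> (\<exists>s\<in>N \<omega>. dist u s \<le> dth) \<and> (\<exists>s\<in>N \<omega>. dist u s \<le> dmax)}"
      by (auto simp: not_le)
    also have "\<dots> = {\<omega> \<in> space M. dth < Y \<omega> \<and> Y \<omega> \<le> dmax}"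
      by (rule Collect_cong, rule conj_cong[OF refl]) (simp add: near dist not_le)
    finally show ?thesis unfolding Psersl_def using between[of dth dmax] dist by simp
  qed

  \<comment> \<open>Law of total probability\<close>
  have \<beta>S: "\<beta>S > 0" using pos by (simp add: \<beta>S_def)
  have FD_pos: "0 < FD x" if "a < x" for x
    using that \<beta>S pos by (simp add: FD_def power_strict_mono)
  have total: "Pout = Pserml / (1 - Pinv) * Poutml + Psersl / (1 - Pinv) * Poutsl"
  proof -
    \<comment> \<open>The case \<open>dth = dmax\<close> is allowed. The side-lobe condition is then
      null and the quotient defining \<open>Poutsl\<close> is 0 by convention, so multiplying out
      needs the numerator to vanish too.\<close>
    have "prob ?Osl' \<le> prob {\<omega> \<in> space M. dth < Y \<omega> \<and> Y \<omega> \<le> dmax}"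
      by (intro finite_measure_mono) auto
    then have "prob ?Osl' = 0" if "FD dmax - FD dth = 0"
      using between[of dth dmax] dist that measure_nonneg[of M ?Osl'] by simp
    then have "(FD dmax - FD dth) * Poutsl = prob ?Osl'" unfolding sl by simp
    moreover have "FD dth * Poutml = prob ?Oml'" unfolding ml using FD_pos[OF dist(1)] by simp
    ultimately show ?thesis unfolding all serml sersl inv by (simp add: add_divide_distrib)
  qed

  \<comment> \<open>Evaluation of the two series\<close>
  have h_cdf': "\<And>x. 0 \<le> x \<Longrightarrow> prob {\<omega> \<in> space M. h \<omega> \<le> x} = SR_cdf b m \<Omega> x"
    using h_cdf by simp
  have \<kappa>_pos: "\<kappa> Gt > 0" if "Gt > 0" for Gt
    using that \<open>P > 0\<close> \<open>g > 0\<close> \<open>Gr > 0\<close> \<open>N0 > 0\<close> \<open>W > 0\<close> \<open>fc > 0\<close> \<open>c > 0\<close> by (simp add: \<kappa>_def)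
  have w: "w1 = (2 powr R - 1) / \<kappa> Gtml" "w2 = (2 powr R - 1) / \<kappa> Gtsl"
    by (simp_all add: w1_def w2_def \<kappa>_def power_divide power_mult_distrib field_simps)
  \<comment> \<open>Inserting the almost sure bound \<open>a < Y\<close> gives the form with a lower
    end. For this lower end the first exponential factor is 1.\<close>
  have "prob ?Oml' = prob {\<omega> \<in> space M. out Gtml \<omega> \<and> a < Y \<omega> \<and> Y \<omega> \<le> dth}"
    using Y_gt_a by (intro finite_measure_eq_AE) (auto elim!: eventually_mono)
  also have "\<dots> = K * (\<Sum>n. cc n * (exp (\<beta>S * a\<^sup>2) * Cml n
        + exp (- \<beta>S * (a\<^sup>2 - a\<^sup>2)) * lower_inc_gamma (1 + real n) (w1 * a powr \<alpha> / (2*b))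
        - exp (- \<beta>S * (dth\<^sup>2 - a\<^sup>2)) * lower_inc_gamma (1 + real n) (w1 * dth powr \<alpha> / (2*b))))"
    unfolding out_def K_def cc_def Cml_def w
    by (rule prob_outage_segment[OF hY h_cdf'])
       (use \<open>b > 0\<close> \<open>m > 0\<close> \<open>\<Omega> > 0\<close> \<open>\<alpha> > 0\<close> \<open>R \<ge> 0\<close> \<kappa>_pos[OF \<open>Gtml > 0\<close>] pos dist tail in auto)
  finally have ml_sum: "prob ?Oml' = K * (\<Sum>n. cc n * (exp (\<beta>S * a\<^sup>2) * Cml n
        + lower_inc_gamma (1 + real n) (w1 * a powr \<alpha> / (2*b))
        - exp (- \<beta>S * (dth\<^sup>2 - a\<^sup>2)) * lower_inc_gamma (1 + real n) (w1 * dth powr \<alpha> / (2*b))))"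
    by simp
  have sl_sum: "prob ?Osl' = K * (\<Sum>n. cc n * (exp (\<beta>S * a\<^sup>2) * Csl n
        + exp (- \<beta>S * (dth\<^sup>2 - a\<^sup>2)) * lower_inc_gamma (1 + real n) (w2 * dth powr \<alpha> / (2*b))
        - exp (- \<beta>S * (dmax\<^sup>2 - a\<^sup>2)) * lower_inc_gamma (1 + real n) (w2 * dmax powr \<alpha> / (2*b))))"
    unfolding out_def K_def cc_def Csl_def w
    by (rule prob_outage_segment[OF hY h_cdf'])
       (use \<open>b > 0\<close> \<open>m > 0\<close> \<open>\<Omega> > 0\<close> \<open>\<alpha> > 0\<close> \<open>R \<ge> 0\<close> \<kappa>_pos[OF \<open>Gtsl > 0\<close>] pos dist tail in auto)
  show ?thesis
    using total unfolding ml sl ml_sum sl_sum by simp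
qed

end
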